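(* Consider the algorithm D--NG run with step-size $\alpha_k = c/(k+1)$, $c>0$, on the problem of minimizing $f=\sum_{i=1}^N f_i$ over $\mathbb{R}^d$, where the weight matrix $W$ satisfies $\mu:=\mu(W)<1$ and $W\succeq \eta I$ with $\eta\in(0,1)$; $f$ has a minimizer; every $f_i:\mathbb{R}^d\to\mathbb{R}$ is convex and differentiable with $\|\nabla f_i(x)-\nabla f_i(y)\|\le L\|x-y\|$ for all $x,y\in\mathbb{R}^d$; and $\|\nabla f_i(x)\|\le G$ for all $x\in\mathbb{R}^d$ and all $i$ ($L,G\in[0,\infty)$). Let $x^\star$ be a minimizer of $f$, $f^\star=f(x^\star)$, and let $\|\overline{x}(0)-x^\star\|\le R$, $R\ge 0$. Let $$\mathcal{B}(r)=\sup_{z\ge 1/2}\left(z\,r^z\log(1+z)\right),\ r\in(0,1),\qquad C_{\mathrm{cons}}=\frac{8\left\{2\,\mathcal{B}(\sqrt{\mu})+\frac{7}{1-\mu}\right\}}{\sqrt{\eta(1-\mu)}} .$$ Then: (a) If $c\le 1/(2L)$, then for all $i=1,\dots,N$ and all $k=1,2,\dots$, $$\frac{f(x_i(k))-f^\star}{N}\le \frac{2R^2}{c}\,\frac1k+16c^2 L\,C_{\mathrm{cons}}^2G^2\left(\frac1k\sum_{t=1}^{k-1}\frac{(t+2)^2}{(t+1)t^2}\right)+c\sqrt{N}\,G^2C_{\mathrm{cons}}\,\frac1k\ \le\ \mathcal{C}\left(\frac1k\sum_{t=1}^{k}\frac{(t+2)^2}{(t+1)t^2}\right),$$ where $\mathcal{C}=\frac{2R^2}{c}+16c^2LC_{\mathrm{cons}}^2G^2+c\sqrt{N}\,G^2C_{\mathrm{cons}}$.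 (b) Let $x_i(0)=y_i(0)=0$ for all $i$. If $c>1/(2L)$, then for all $i$ and all $k\ge 2cL$, $$\frac{f(x_i(k))-f^\star}{N}\le \mathcal{C}'\left(\frac1k\sum_{t=1}^{k}\frac{(t+2)^2}{(t+1)t^2}\right),\qquad \mathcal{C}'=\mathcal{C}''(L,G,R,c)+16c^2LC_{\mathrm{cons}}^2G^2+c\sqrt{N}\,G^2C_{\mathrm{cons}},$$ where $\mathcal{C}''(L,G,R,c)\in[0,\infty)$ is a constant that depends only on $L,G,R,c$ and is independent of $N$ and $W$.
   Context: Network: $N\ge 2$ nodes; $\mathcal{G}=(\mathcal{N},E)$ is a connected, undirected, simple graph on them. $W$ is a symmetric doubly stochastic (nonnegative entries, rows and columns summing to one) $N\times N$ matrix with, for $i\ne j$, $W_{ij}>0$ if and only if $\{i,j\}\in E$. $O_i$ is the neighborhood of node $i$, including $i$ itself. $J=\frac1N\mathbf{1}\mathbf{1}^\top$, and $\mu(W)=\|W-J\|$ (spectral norm) is the second largest singular value of $W$. $\|\cdot\|$ is the Euclidean norm for vectors; $1/(2L)$ is read as $+\infty$ if $L=0$. Algorithm D--NG: each node $i$ holds $x_i(k),y_i(k)\in\mathbb{R}^d$, with common initialization $x_i(0)=y_i(0)=x_j(0)=y_j(0)$ for all $i,j$, and for $k=1,2,\dots$ $$x_i(k)=\sum_{j\in O_i}W_{ij}\,y_j(k-1)-\alpha_{k-1}\nabla f_i(y_i(k-1)),\qquad y_i(k)=x_i(k)+\beta_{k-1}\left(x_i(k)-x_i(k-1)\right),$$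 with $\alpha_k=\frac{c}{k+1}$, $\beta_k=\frac{k}{k+3}$, $k=0,1,\dots$. Further $\overline{x}(k)=\frac1N\sum_{i=1}^N x_i(k)$. *)

theory Defs
  imports "HOL-Analysis.Analysis"
begin

text \<open>
  The dimension and the number of nodes have to be quantified below an existential
  quantifier over real functions, so they are natural numbers and not types. All spaces
  \<open>\<real>\<^sup>n\<close> live inside one real inner product space, the finitely supported real sequences:
  \<open>rspace n\<close> consists of the sequences whose coordinates of index \<open>n\<close> and above vanish, with
  the Euclidean inner product and norm. Coordinates and nodes are numbered from \<open>0\<close>.
\<close>

typedef rvec = "{x :: nat \<Rightarrow> real. finite {i. x i \<noteq> 0}}"
  morphisms coord Rvec
  by (rule exI[of _ "\<lambda>_. 0"]) simp

setup_lifting type_definition_rvec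

lemma finite_supp: "finite {i. coord x i \<noteq> 0}"
  using coord[of x] by simp

lemma rvec_eqI: "(\<And>i. coord x i = coord y i) \<Longrightarrow> x = y"
  by (metis coord_inject ext)

instantiation rvec :: real_vector
begin

lift_definition zero_rvec :: rvec is "\<lambda>_. 0"
  by simp

lift_definition plus_rvec :: "rvec \<Rightarrow> rvec \<Rightarrow> rvec" is "\<lambda>x y i. x i + y i"
  subgoal for x y
    by (rule finite_subset[of _ "{i. x i \<noteq> 0} \<union> {i. y i \<noteq> 0}"]) auto
  done

lift_definition uminus_rvec :: "rvec \<Rightarrow> rvec" is "\<lambda>x i. - x i"
  by simp

lift_definition minus_rvec :: "rvec \<Rightarrow> rvec \<Rightarrow> rvec" is "\<lambda>x y i. x i - y i"
  subgoal for x y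
    by (rule finite_subset[of _ "{i. x i \<noteq> 0} \<union> {i. y i \<noteq> 0}"]) auto
  done

lift_definition scaleR_rvec :: "real \<Rightarrow> rvec \<Rightarrow> rvec" is "\<lambda>r x i. r * x i"
  subgoal for r x
    by (rule finite_subset[of _ "{i. x i \<noteq> 0}"]) auto
  done

instance
  by standard (auto intro!: rvec_eqI simp: zero_rvec.rep_eq plus_rvec.rep_eq uminus_rvec.rep_eq
      minus_rvec.rep_eq scaleR_rvec.rep_eq distrib_left distrib_right)

end

instantiation rvec :: real_inner
begin

definition inner_rvec :: "rvec \<Rightarrow> rvec \<Rightarrow> real"
  where "inner_rvec x y = (\<Sum>i | coord x i \<noteq> 0. coord x i * coord y i)"

definition norm_rvec :: "rvec \<Rightarrow> real"
  where "norm_rvec x = sqrt (inner x x)"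

definition sgn_rvec :: "rvec \<Rightarrow> rvec"
  where "sgn_rvec x = inverse (norm x) *\<^sub>R x"

definition dist_rvec :: "rvec \<Rightarrow> rvec \<Rightarrow> real"
  where "dist_rvec x y = norm (x - y)"

definition uniformity_rvec :: "(rvec \<times> rvec) filter"
  where "uniformity_rvec = (INF e\<in>{0<..}. principal {(x, y). dist x y < e})"

definition open_rvec :: "rvec set \<Rightarrow> bool"
  where "open_rvec U \<longleftrightarrow> (\<forall>x\<in>U. eventually (\<lambda>(x', y). x' = x \<longrightarrow> y \<in> U) uniformity)"

lemma inner_rvec_superset:
  assumes "finite A" "{i. coord x i \<noteq> 0} \<subseteq> A"
  shows "inner x y = (\<Sum>i\<in>A. coord x i * coord y i)"
  unfolding inner_rvec_def using assms by (intro sum.mono_neutral_left) auto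

instance
proof
  fix x y z :: rvec and r :: real
  define A where "A = {i. coord x i \<noteq> 0} \<union> {i. coord y i \<noteq> 0}"
  have A: "finite A" "{i. coord x i \<noteq> 0} \<subseteq> A" "{i. coord y i \<noteq> 0} \<subseteq> A"
    "{i. coord (x + y) i \<noteq> 0} \<subseteq> A" "{i. coord (r *\<^sub>R x) i \<noteq> 0} \<subseteq> A"
    by (auto simp: A_def finite_supp plus_rvec.rep_eq scaleR_rvec.rep_eq)
  show "inner x y = inner y x"
    using A by (simp add: inner_rvec_superset[of A] mult.commute)
  show "inner (x + y) z = inner x z + inner y z"
    using A by (simp add: inner_rvec_superset[of A] plus_rvec.rep_eq sum.distrib distrib_right)
  show "inner (r *\<^sub>R x) y = r * inner x y"
    using A by (simp add: inner_rvec_superset[of A] scaleR_rvec.rep_eq sum_distrib_left mult.assoc)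
  show "0 \<le> inner x x"
    by (simp add: inner_rvec_def sum_nonneg)
  have "coord x i = 0" if "inner x x = 0" for i
    using that by (auto simp: inner_rvec_def sum_nonneg_eq_0_iff finite_supp)
  then show "(inner x x = 0) = (x = 0)"
    by (metis (no_types, lifting) rvec_eqI zero_rvec.rep_eq inner_rvec_def mult_zero_left sum.neutral)
qed (fact dist_rvec_def sgn_rvec_def uniformity_rvec_def open_rvec_def norm_rvec_def)+

end

definition rspace :: "nat \<Rightarrow> rvec set"
  where "rspace n = {x. \<forall>i\<ge>n. coord x i = 0}"

text \<open>An \<open>n \<times> n\<close> matrix is a function of which only the entries with indices below \<open>n\<close> are used.\<close>

lift_definition matvec :: "nat \<Rightarrow> (nat \<Rightarrow> nat \<Rightarrow> real) \<Rightarrow> rvec \<Rightarrow> rvec"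
  is "\<lambda>n A v i. if i < n then \<Sum>j<n. A i j * v j else 0"
  subgoal for n A v
    by (rule finite_subset[of _ "{..<n}"]) (auto split: if_splits)
  done

text \<open>
  \<open>onorm\<close> ranges over all of \<open>rvec\<close>. Since \<open>matvec n A\<close> ignores the coordinates of index \<open>n\<close>
  and above, this is the operator norm on \<open>\<real>\<^sup>n\<close>.
\<close>

definition spectral_norm :: "nat \<Rightarrow> (nat \<Rightarrow> nat \<Rightarrow> real) \<Rightarrow> real"
  where "spectral_norm n A = onorm (matvec n A)"

definition mu :: "nat \<Rightarrow> (nat \<Rightarrow> nat \<Rightarrow> real) \<Rightarrow> real"
  where "mu N W = spectral_norm N (\<lambda>i j. W i j - 1 / real N)"

definition symmetric_matrix :: "nat \<Rightarrow> (nat \<Rightarrow> nat \<Rightarrow> real) \<Rightarrow> bool"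
  where "symmetric_matrix n A \<longleftrightarrow> (\<forall>i<n. \<forall>j<n. A i j = A j i)"

definition pos_semidef :: "nat \<Rightarrow> (nat \<Rightarrow> nat \<Rightarrow> real) \<Rightarrow> bool"
  where "pos_semidef n A \<longleftrightarrow>
    symmetric_matrix n A \<and> (\<forall>v\<in>rspace n. 0 \<le> inner v (matvec n A v))"

definition doubly_stochastic :: "nat \<Rightarrow> (nat \<Rightarrow> nat \<Rightarrow> real) \<Rightarrow> bool"
  where "doubly_stochastic n A \<longleftrightarrow>
    (\<forall>i<n. \<forall>j<n. 0 \<le> A i j) \<and> (\<forall>i<n. (\<Sum>j<n. A i j) = 1) \<and> (\<forall>j<n. (\<Sum>i<n. A i j) = 1)"

definition simple_graph :: "nat \<Rightarrow> nat set set \<Rightarrow> bool"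
  where "simple_graph N E \<longleftrightarrow> E \<subseteq> {{i, j} |i j. i < N \<and> j < N \<and> i \<noteq> j}"

definition connected_graph :: "nat \<Rightarrow> nat set set \<Rightarrow> bool"
  where "connected_graph N E \<longleftrightarrow> (\<forall>i<N. \<forall>j<N. (i, j) \<in> {(u, v). {u, v} \<in> E}\<^sup>*)"

definition neighborhood :: "nat set set \<Rightarrow> nat \<Rightarrow> nat set"
  where "neighborhood E i = insert i {j. {i, j} \<in> E}"

definition weight_matrix :: "nat \<Rightarrow> nat set set \<Rightarrow> (nat \<Rightarrow> nat \<Rightarrow> real) \<Rightarrow> bool"
  where "weight_matrix N E W \<longleftrightarrow>
    symmetric_matrix N W \<and> doubly_stochastic N W \<and>
    (\<forall>i<N. \<forall>j<N. i \<noteq> j \<longrightarrow> (0 < W i j \<longleftrightarrow> {i, j} \<in> E))"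

definition has_gradient :: "nat \<Rightarrow> (rvec \<Rightarrow> real) \<Rightarrow> rvec \<Rightarrow> rvec \<Rightarrow> bool"
  where "has_gradient d f g z \<longleftrightarrow>
    g \<in> rspace d \<and> (f has_derivative (\<lambda>h. inner h g)) (at z within rspace d)"

definition average :: "nat \<Rightarrow> (nat \<Rightarrow> rvec) \<Rightarrow> rvec"
  where "average N x = (1 / real N) *\<^sub>R (\<Sum>i<N. x i)"

definition step_size :: "real \<Rightarrow> nat \<Rightarrow> real"
  where "step_size c k = c / (real k + 1)"

definition momentum :: "nat \<Rightarrow> real"
  where "momentum k = real k / (real k + 3)"

definition dng_iterates ::
    "nat \<Rightarrow> nat set set \<Rightarrow> (nat \<Rightarrow> nat \<Rightarrow> real) \<Rightarrow> nat \<Rightarrow> (nat \<Rightarrow> rvec \<Rightarrow> rvec) \<Rightarrow> real \<Rightarrow>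
      (nat \<Rightarrow> nat \<Rightarrow> rvec) \<Rightarrow> (nat \<Rightarrow> nat \<Rightarrow> rvec) \<Rightarrow> bool"
  where "dng_iterates N E W d grad c x y \<longleftrightarrow>
    (\<exists>x0\<in>rspace d. \<forall>i<N. x i 0 = x0 \<and> y i 0 = x0) \<and>
    (\<forall>i<N. \<forall>k\<ge>1.
      x i k = (\<Sum>j\<in>neighborhood E i. W i j *\<^sub>R y j (k - 1))
                - step_size c (k - 1) *\<^sub>R grad i (y i (k - 1)) \<and>
      y i k = x i k + momentum (k - 1) *\<^sub>R (x i k - x i (k - 1)))"

definition B_const :: "real \<Rightarrow> real"
  where "B_const r = (SUP z\<in>{1/2..}. z * r powr z * ln (1 + z))"

definition C_cons :: "real \<Rightarrow> real \<Rightarrow> real"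
  where "C_cons m \<eta> = 8 * (2 * B_const (sqrt m) + 7 / (1 - m)) / sqrt (\<eta> * (1 - m))"

definition inv_2L :: "real \<Rightarrow> ereal"
  where "inv_2L L = (if L = 0 then \<infinity> else ereal (1 / (2 * L)))"

definition rate :: "nat \<Rightarrow> nat \<Rightarrow> real"
  where "rate k n = 1 / real k * (\<Sum>t=1..n. (real t + 2)\<^sup>2 / ((real t + 1) * (real t)\<^sup>2))"

end

theory Submission
  imports Defs
begin

text \<open>
  Consensus: on the mean-zero subspace \<open>0 < W \<le> \<mu>\<close>, and for any momentum \<open>\<beta> \<in> [0, 1]\<close> the
  quadratic form \<open>\<langle>p, (I - W) p\<rangle> + \<langle>q, W q\<rangle>\<close> in the disagreement \<open>p\<close> and its increment \<open>q\<close> shrinks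
  by the factor \<open>\<mu>\<close> in every gradient-free step. The gradient terms, of size \<open>c \<surd>N G / (t + 1)\<close>, are
  therefore damped geometrically at the rate \<open>\<surd>\<mu>\<close>, and the convolution of the two sequences is
  \<open>O(1/k)\<close>.

  Optimization: the averages follow Nesterov's method for \<open>f / N\<close> with a gradient that is inexact by
  \<open>L / (2 N)\<close> times the squared disagreement of the \<open>y\<^sub>i\<close>. With step size \<open>c / (k + 1)\<close> the function
  \<open>(k + 1)\<^sup>2 / k * (f(x\<^sub>k) - f\<^sup>\<star>) / N + 2 / c * \<parallel>v\<^sub>k - x\<^sup>\<star>\<parallel>\<^sup>2\<close> of the averaged iterates grows only by the
  weighted errors, as soon as \<open>c L \<le> k + 1\<close>. For large \<open>c\<close> one starts at \<open>k = \<lceil>2cL\<rceil>\<close>, where this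
  function is bounded in terms of \<open>L\<close>, \<open>G\<close>, \<open>R\<close>, \<open>c\<close> because gradients are bounded.
\<close>

section \<open>Consensus\<close>

text \<open>Stands for the weight matrix on mean-zero vectors: the two form bounds put its spectrum
  on \<open>S\<close> into \<open>[0, m]\<close>. The lemmas derive polynomial inequalities on the
  spectrum from squares, without an eigenbasis.\<close>

locale contraction_operator =
  fixes W :: "'a::real_inner \<Rightarrow> 'a" and S :: "'a set" and m :: real
  assumes linear: "linear W"
    and selfadjoint: "inner (W u) v = inner u (W v)"
    and subspace: "subspace S"
    and maps: "u \<in> S \<Longrightarrow> W u \<in> S"
    and nonneg: "u \<in> S \<Longrightarrow> 0 \<le> inner u (W u)"
    and upper: "u \<in> S \<Longrightarrow> inner u (W u) \<le> m * inner u u"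
    and m_pos: "0 < m" and m_less: "m < 1"
begin

text \<open>
  For a constant momentum \<open>1\<close> the recursion on an eigenvector of eigenvalue \<open>\<lambda>\<close> has the
  characteristic polynomial \<open>s\<^sup>2 - 2 * \<lambda> * s + \<lambda>\<close>, and the energy is the quadratic form that
  this recursion multiplies by exactly \<open>\<lambda>\<close>, written in the position \<open>p\<close> and the increment \<open>q\<close>.
\<close>

definition energy :: "'a \<Rightarrow> 'a \<Rightarrow> real"
  where "energy p q = inner p p - inner p (W p) + inner q (W q)"

lemmas W_simps = linear_add[OF linear] linear_diff[OF linear] linear_cmul[OF linear]

lemma inner_swap: "inner u (W v) = inner v (W u)"
  by (metis selfadjoint inner_commute)

lemma inner_swap2: "inner u (W (W v)) = inner v (W (W u))"
  by (metis selfadjoint inner_commute)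

lemma inner_swap3: "inner u (W (W (W v))) = inner v (W (W (W u)))"
  by (metis selfadjoint inner_commute)

text \<open>On the spectrum this is \<open>s * (m - s) >= 0\<close>. It combines
  \<open>s * (m - s)^2 >= 0\<close>, which is nonnegativity at \<open>m u - W u\<close>, with
  \<open>s^3 <= m * s^2\<close>, the upper bound at \<open>W u\<close>.\<close>

lemma square_le:
  assumes "u \<in> S"
  shows "inner u (W (W u)) \<le> m * inner u (W u)"
proof -
  let ?a = "inner u (W u)" and ?b = "inner u (W (W u))" and ?e = "inner u (W (W (W u)))"
  have in_S: "m *\<^sub>R u - W u \<in> S"
    using assms maps subspace by (simp add: subspace_diff subspace_mul)
  have "0 \<le> inner (m *\<^sub>R u - W u) (W (m *\<^sub>R u - W u))"
    by (rule nonneg[OF in_S])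
  also have "\<dots> = m\<^sup>2 * ?a - 2 * m * ?b + ?e"
    by (simp add: W_simps inner_diff_left inner_diff_right selfadjoint algebra_simps power2_eq_square)
  finally have 1: "0 \<le> m\<^sup>2 * ?a - 2 * m * ?b + ?e" .
  have 2: "?e \<le> m * ?b"
    using upper[OF maps[OF assms]] by (simp add: selfadjoint)
  have "0 \<le> m * (m * ?a - ?b)"
    using 1 2 by (simp add: power2_eq_square algebra_simps)
  then show ?thesis
    using m_pos by (simp add: zero_le_mult_iff)
qed

text \<open>On the spectrum, \<open>(1 - s) * (m - s) = (m - s)^2 + (1 - m) * (m - s)\<close>, a sum
  of two nonnegative terms.\<close>

lemma square_mix_le:
  assumes "u \<in> S"
  shows "inner u (W u) - inner u (W (W u)) \<le> m * (inner u u - inner u (W u))"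
proof -
  have "0 \<le> inner (m *\<^sub>R u - W u) (m *\<^sub>R u - W u)"
    by simp
  also have "\<dots> = m\<^sup>2 * inner u u - 2 * m * inner u (W u) + inner u (W (W u))"
    by (simp add: inner_diff_left inner_diff_right selfadjoint algebra_simps power2_eq_square)
  finally have 1: "0 \<le> \<dots>" .
  have 2: "0 \<le> (1 - m) * (m * inner u u - inner u (W u))"
    using upper[OF assms] m_less by simp
  from 1 2 show ?thesis by (simp add: power2_eq_square algebra_simps)
qed

lemma energy_ge:
  assumes "p \<in> S" "q \<in> S"
  shows "(1 - m) * (norm p)\<^sup>2 \<le> energy p q"
  using upper[OF assms(1)] nonneg[OF assms(2)]
  by (simp add: energy_def power2_norm_eq_inner algebra_simps)

lemma energy_nonneg:
  assumes "p \<in> S" "q \<in> S"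
  shows "0 \<le> energy p q"
  using energy_ge[OF assms] m_less
  by (smt (verit) mult_nonneg_nonneg zero_le_power2)

text \<open>The cross terms of the two squares cancel, so the momentum only damps the energy.\<close>

lemma energy_step:
  assumes "p \<in> S" "q \<in> S" "0 \<le> b" "b \<le> 1"
  shows "energy (W (p + b *\<^sub>R q)) (W (p + b *\<^sub>R q) - p) \<le> m * energy p q"
proof -
  have "energy (W (p + b *\<^sub>R q)) (W (p + b *\<^sub>R q) - p)
      = (inner p (W p) - inner p (W (W p))) + b\<^sup>2 * inner q (W (W q))"
    using inner_swap[of q p] inner_swap2[of q p] inner_swap3[of q p]
    by (simp add: energy_def W_simps inner_diff_left inner_diff_right inner_add_left inner_add_right
        selfadjoint algebra_simps power2_eq_square)
  also have "\<dots> \<le> m * (inner p p - inner p (W p)) + m * inner q (W q)"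
  proof (rule add_mono[OF square_mix_le[OF assms(1)]])
    have "b\<^sup>2 \<le> 1" using assms by (simp add: power_le_one)
    moreover have "0 \<le> inner q (W (W q))"
      by (metis selfadjoint inner_ge_zero)
    ultimately have "b\<^sup>2 * inner q (W (W q)) \<le> 1 * inner q (W (W q))"
      by (intro mult_right_mono)
    then show "b\<^sup>2 * inner q (W (W q)) \<le> m * inner q (W q)"
      using square_le[OF assms(2)] by simp
  qed
  finally show ?thesis by (simp add: energy_def algebra_simps)
qed

text \<open>A gradient step displaces the position and its increment by the same \<open>u\<close>.
  Along such directions the \<open>W\<close> terms cancel and the part quadratic in \<open>u\<close>
  is exactly \<open>(norm u)^2\<close>, so bounding the linear part yields a triangle
  inequality.\<close>

lemma sqrt_energy_add:
  assumes "p \<in> S" "q \<in> S"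
  shows "sqrt (energy (p + u) (q + u)) \<le> sqrt (energy p q) + norm u"
proof -
  \<comment> \<open>The part of the displaced energy linear in \<open>u\<close> is
    \<open>2 * inner ?z u\<close>.\<close>
  let ?z = "p - W (p - q)"
  have "(norm ?z)\<^sup>2 = inner p p - 2 * inner p (W (p - q)) + inner (p - q) (W (W (p - q)))"
    unfolding power2_norm_eq_inner
    using selfadjoint[of "p - q" "W (p - q)"] inner_commute[of p "W (p - q)"]
    by (simp add: inner_diff_left inner_diff_right)
  \<comment> \<open>\<open>W^2\<close> lies below \<open>W\<close> on \<open>S\<close> because the
    spectrum lies in \<open>[0, m]\<close> with \<open>m < 1\<close>.\<close>
  also have "inner (p - q) (W (W (p - q))) \<le> inner (p - q) (W (p - q))"
  proof -
    have in_S: "p - q \<in> S" using assms subspace by (simp add: subspace_diff)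
    have "m * inner (p - q) (W (p - q)) \<le> 1 * inner (p - q) (W (p - q))"
      using m_less nonneg[OF in_S] by (intro mult_right_mono) auto
    then show ?thesis using square_le[OF in_S] by simp
  qed
  also have "inner p p - 2 * inner p (W (p - q)) + inner (p - q) (W (p - q)) = energy p q"
    using inner_swap[of q p]
    by (simp add: energy_def W_simps inner_diff_left inner_diff_right)
  finally have "norm ?z \<le> sqrt (energy p q)"
    by (simp add: real_le_rsqrt)
  then have *: "inner ?z u \<le> sqrt (energy p q) * norm u"
    by (meson norm_cauchy_schwarz norm_ge_zero mult_right_mono order_trans)
  have "energy (p + u) (q + u) = energy p q + 2 * inner ?z u + (norm u)\<^sup>2"
    using inner_swap[of u p] inner_swap[of u q]
    by (simp add: energy_def power2_norm_eq_inner W_simps inner_diff_left inner_diff_right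
        selfadjoint inner_commute algebra_simps)
  also have "\<dots> \<le> (sqrt (energy p q) + norm u)\<^sup>2"
    using * energy_nonneg[OF assms] by (simp add: power2_sum)
  finally show ?thesis
    using energy_nonneg[OF assms] by (intro real_le_lsqrt) auto
qed

text \<open>Unrolls a one-step bound on the root of the energy: the momentum step contracts it by
  \<open>sqrt m\<close>, the forcing adds at most \<open>a k * norm (u k)\<close>. Returning from
  the energy to the norm of \<open>p k\<close> costs the factor \<open>sqrt (1 - m)\<close>.\<close>

lemma momentum_recursion_bound:
  fixes p u :: "nat \<Rightarrow> 'a" and b a :: "nat \<Rightarrow> real"
  assumes p0: "p 0 = 0"
    and step: "\<And>k. p (Suc k) = W (p k + b k *\<^sub>R (p k - p (k - 1))) - a k *\<^sub>R u k"
    and in_S: "\<And>k. p k \<in> S"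
    and b: "\<And>k. 0 \<le> b k" "\<And>k. b k \<le> 1" and a: "\<And>k. 0 \<le> a k"
  shows "sqrt (1 - m) * norm (p k) \<le> (\<Sum>t<k. sqrt m ^ (k - 1 - t) * a t * norm (u t))"
proof -
  \<comment> \<open>At \<open>k = 0\<close> natural subtraction gives \<open>k - 1 = 0\<close>, so
    the initial increment is zero and so is the initial energy.\<close>
  define q where "q k = sqrt (energy (p k) (p k - p (k - 1)))" for k
  have diff_S: "p i - p j \<in> S" for i j
    using in_S subspace by (simp add: subspace_diff)
  have q0: "q 0 = 0" by (simp add: q_def energy_def p0)
  have q_Suc: "q (Suc k) \<le> sqrt m * q k + a k * norm (u k)" for k
  proof -
    let ?w = "W (p k + b k *\<^sub>R (p k - p (k - 1)))"
    have w: "?w \<in> S"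
      using in_S diff_S subspace by (intro maps) (simp add: subspace_add subspace_mul)
    have w': "?w - p k \<in> S"
      using w in_S subspace by (simp add: subspace_diff)
    have "q (Suc k) = sqrt (energy (?w + - (a k *\<^sub>R u k)) (?w - p k + - (a k *\<^sub>R u k)))"
      unfolding q_def step by (simp add: algebra_simps)
    also have "\<dots> \<le> sqrt (energy ?w (?w - p k)) + norm (- (a k *\<^sub>R u k))"
      by (rule sqrt_energy_add[OF w w'])
    also have "\<dots> \<le> sqrt m * q k + a k * norm (u k)"
      using energy_step[OF in_S[of k] diff_S[of k "k - 1"] b(1)[of k] b(2)[of k]] a
      by (simp add: q_def flip: real_sqrt_mult)
    finally show ?thesis .
  qed
  have "q k \<le> (\<Sum>t<k. sqrt m ^ (k - 1 - t) * a t * norm (u t))" for k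
  proof (induction k)
    case 0
    then show ?case by (simp add: q0)
  next
    case (Suc k)
    have "sqrt m * (\<Sum>t<k. sqrt m ^ (k - 1 - t) * a t * norm (u t))
        = (\<Sum>t<k. sqrt m ^ (Suc k - 1 - t) * a t * norm (u t))"
      unfolding sum_distrib_left
    proof (rule sum.cong[OF refl])
      fix t assume "t \<in> {..<k}"
      then have "Suc k - 1 - t = Suc (k - 1 - t)" by auto
      then show "sqrt m * (sqrt m ^ (k - 1 - t) * a t * norm (u t))
          = sqrt m ^ (Suc k - 1 - t) * a t * norm (u t)"
        by simp
    qed
    moreover have "sqrt m * q k \<le> sqrt m * (\<Sum>t<k. sqrt m ^ (k - 1 - t) * a t * norm (u t))"
      using Suc m_pos by (intro mult_left_mono) auto
    ultimately show ?case using q_Suc[of k] by simp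
  qed
  moreover have "sqrt (1 - m) * norm (p k) \<le> q k"
    using energy_ge[OF in_S[of k] diff_S[of k "k - 1"]] m_less
    by (auto simp: q_def real_sqrt_mult intro!: real_le_rsqrt simp: power_mult_distrib)
  ultimately show ?thesis using order_trans by blast
qed

end

section \<open>Geometric decay against linear and harmonic factors\<close>

lemma mult_powr_le:
  fixes r z :: real
  assumes "0 < r" "r < 1" "0 \<le> z"
  shows "z * r powr z \<le> 1 / (1 - r)"
proof -
  \<comment> \<open>The chain is
    \<open>z * (1 - r) <= - z * ln r <= exp (- z * ln r) = r powr (- z)\<close>, the second
    inequality being \<open>t <= exp t\<close>.\<close>
  have "1 - r \<le> - ln r" using ln_le_minus_one[of r] assms by simp
  then have "z * (1 - r) \<le> z * (- ln r)" using assms by (intro mult_left_mono)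
  also have "\<dots> \<le> exp (z * (- ln r))" using exp_ge_add_one_self[of "z * (- ln r)"] by linarith
  finally have "z * (1 - r) * r powr z \<le> exp (z * (- ln r)) * r powr z"
    by (intro mult_right_mono) auto
  also have "\<dots> = 1" using assms by (simp add: powr_def flip: exp_add)
  finally show ?thesis using assms by (simp add: field_simps)
qed

text \<open>The point is that the supremum is over a bounded set: \<open>ln (1 + z) <= z\<close>,
  and \<open>z^2 * r powr z\<close> is the square of \<open>z * sqrt r powr z\<close>, which is
  bounded.\<close>

lemma B_const_upper:
  assumes "0 < r" "r < 1" "1/2 \<le> z"
  shows "z * r powr z * ln (1 + z) \<le> B_const r"
  unfolding B_const_def
proof (rule cSUP_upper)
  show "z \<in> {1/2..}" using assms by simp
  show "bdd_above ((\<lambda>z. z * r powr z * ln (1 + z)) ` {1/2..})"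
  proof (rule bdd_aboveI2)
    fix z :: real assume z: "z \<in> {1/2..}"
    have r: "0 < sqrt r" "sqrt r < 1" using assms by auto
    have "z * r powr z * ln (1 + z) \<le> z * r powr z * z"
      using z ln_add_one_self_le_self[of z] by (intro mult_left_mono) auto
    also have "\<dots> = (z * sqrt r powr z) * (z * sqrt r powr z)"
      using assms by (simp add: powr_mult flip: real_sqrt_mult powr_mult)
    also have "\<dots> \<le> (1 / (1 - sqrt r)) * (1 / (1 - sqrt r))"
      using z r by (intro mult_mono mult_powr_le) auto
    finally show "z * r powr z * ln (1 + z) \<le> (1 / (1 - sqrt r)) * (1 / (1 - sqrt r))" .
  qed
qed

lemma B_const_nonneg:
  assumes "0 < r" "r < 1"
  shows "0 \<le> B_const r"
proof -
  have "0 \<le> 1 * r powr 1 * ln (1 + 1)" using assms by simp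
  also have "\<dots> \<le> B_const r" using assms by (intro B_const_upper) auto
  finally show ?thesis .
qed

lemma sum_inverse_le_ln:
  assumes "1 \<le> k"
  shows "(\<Sum>t<k. 1 / (real t + 1)) \<le> 1 + ln (real k)"
  using assms
proof (induction k rule: nat_induct_at_least)
  case base
  then show ?case by simp
next
  case (Suc k)
  have "ln (real k / (real k + 1)) \<le> real k / (real k + 1) - 1"
    using Suc.hyps by (intro ln_le_minus_one) auto
  also have "\<dots> = - (1 / (real k + 1))" by (simp add: field_simps)
  finally have "1 / (real k + 1) \<le> ln (real k + 1) - ln (real k)"
    using Suc.hyps by (simp add: ln_div)
  then show ?case using Suc.IH by (simp add: add.commute)
qed

text \<open>With ratio \<open>sqrt \<mu>\<close> the sum is the accumulated effect of all damped
  steps, up to a constant factor, so this is where the consensus error becomes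
  \<open>O(1/k)\<close>.\<close>

lemma geometric_harmonic_convolution_le:
  assumes r: "0 < r" "r < 1" and k: "1 \<le> k"
  shows "real k * (\<Sum>t<k. r ^ (k - 1 - t) / (real t + 1)) \<le> 2 * B_const r + 6 / (1 - r)"
proof -
  \<comment> \<open>The sum is split near half of \<open>k\<close>; as \<open>k >= 1\<close>, this
    \<open>z\<close> is in the range \<open>z >= 1/2\<close> of the supremum defining
    \<open>B_const\<close>.\<close>
  define z where "z = real k / 2"
  have z: "1/2 \<le> z" "real k = 2 * z" using k by (auto simp: z_def)
  \<comment> \<open>Late terms have a small harmonic factor, early terms a small geometric one.\<close>
  have term_le: "r ^ (k - 1 - t) / (real t + 1)
      \<le> 2 / real k * r ^ (k - 1 - t) + r powr z * (1 / (real t + 1))" if "t < k" for t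
  proof (cases "real k \<le> 2 * (real t + 1)")
    case True
    then have "1 / (real t + 1) \<le> 2 / real k" using k by (simp add: field_simps)
    then have "r ^ (k - 1 - t) * (1 / (real t + 1)) \<le> r ^ (k - 1 - t) * (2 / real k)"
      using r by (intro mult_left_mono) auto
    then show ?thesis by (simp add: add_increasing2 mult.commute)
  next
    case False
    have "r ^ (k - 1 - t) = r powr real (k - 1 - t)" using r by (simp add: powr_realpow)
    also have "\<dots> \<le> r powr z"
      using False that r by (intro powr_mono') (auto simp: z_def of_nat_diff)
    finally have "r ^ (k - 1 - t) / (real t + 1) \<le> r powr z / (real t + 1)"
      by (intro divide_right_mono) auto
    moreover have "0 \<le> 2 / real k * r ^ (k - 1 - t)" using r by simp
    ultimately show ?thesis by simp
  qed
  have "(\<Sum>t<k. r ^ (k - 1 - t)) = (\<Sum>t<k. r ^ t)"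
    by (rule sum.reindex_bij_witness[where i="\<lambda>t. k - 1 - t" and j="\<lambda>t. k - 1 - t"]) auto
  also have "\<dots> \<le> 1 / (1 - r)"
  proof -
    have "(\<Sum>t<k. r ^ t) = (1 - r ^ k) / (1 - r)" using r by (simp add: sum_gp_strict)
    then show ?thesis using r by (simp add: divide_right_mono)
  qed
  finally have geo: "(\<Sum>t<k. r ^ (k - 1 - t)) \<le> 1 / (1 - r)" .
  \<comment> \<open>Since \<open>k = 2 z\<close>, this produces the logarithm occurring in
    \<open>B_const\<close>; the constant \<open>1 + ln 2\<close> is rounded up to
    \<open>2\<close>.\<close>
  have "ln (real k) \<le> ln (2 * (1 + z))" using z k by (intro ln_mono) auto
  also have "\<dots> = ln 2 + ln (1 + z)" using z by (subst ln_mult) auto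
  finally have harm: "(\<Sum>t<k. 1 / (real t + 1)) \<le> 2 + ln (1 + z)"
    using sum_inverse_le_ln[OF k] ln_2_less_1 by linarith
  have "(\<Sum>t<k. r ^ (k - 1 - t) / (real t + 1))
      \<le> (\<Sum>t<k. 2 / real k * r ^ (k - 1 - t) + r powr z * (1 / (real t + 1)))"
    using term_le by (intro sum_mono) auto
  also have "\<dots> = 2 / real k * (\<Sum>t<k. r ^ (k - 1 - t)) + r powr z * (\<Sum>t<k. 1 / (real t + 1))"
    by (simp only: sum.distrib sum_distrib_left)
  also have "\<dots> \<le> 2 / real k * (1 / (1 - r)) + r powr z * (2 + ln (1 + z))"
    using geo harm by (intro add_mono mult_left_mono) auto
  finally have "real k * (\<Sum>t<k. r ^ (k - 1 - t) / (real t + 1))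
      \<le> real k * (2 / real k * (1 / (1 - r)) + r powr z * (2 + ln (1 + z)))"
    by (intro mult_left_mono) auto
  also have "\<dots> = 2 / (1 - r) + 4 * (z * r powr z) + 2 * (z * r powr z * ln (1 + z))"
  proof -
    have "real k * (2 / real k * (1 / (1 - r))) = 2 / (1 - r)" using k by simp
    then show ?thesis unfolding distrib_left by (simp add: z(2) algebra_simps)
  qed
  also have "\<dots> \<le> 2 / (1 - r) + 4 * (1 / (1 - r)) + 2 * B_const r"
    using z r by (intro add_mono mult_left_mono mult_powr_le B_const_upper) auto
  finally show ?thesis by simp
qed

section \<open>Euclidean spaces of finitely supported sequences\<close>

lemmas coord_simps = zero_rvec.rep_eq plus_rvec.rep_eq uminus_rvec.rep_eq minus_rvec.rep_eq
  scaleR_rvec.rep_eq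

lemma coord_sum: "coord (\<Sum>i\<in>A. f i) l = (\<Sum>i\<in>A. coord (f i) l)"
  by (induction A rule: infinite_finite_induct) (simp_all add: coord_simps)

lemma subspace_rspace: "subspace (rspace n)"
  by (rule subspaceI) (auto simp: rspace_def coord_simps)

lemma inner_rspace:
  assumes "x \<in> rspace n"
  shows "inner x y = (\<Sum>i<n. coord x i * coord y i)"
  using assms by (intro inner_rvec_superset) (auto simp: rspace_def not_le[symmetric])

lemma norm_rspace:
  assumes "x \<in> rspace n"
  shows "norm x = L2_set (coord x) {..<n}"
  using inner_rspace[OF assms, of x]
  by (simp add: norm_eq_sqrt_inner L2_set_def power2_eq_square)

lemma coord_matvec: "coord (matvec n A v) i = (if i < n then \<Sum>j<n. A i j * coord v j else 0)"
  by (simp add: matvec.rep_eq)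

lemma matvec_in_rspace: "matvec n A v \<in> rspace n"
  by (simp add: rspace_def coord_matvec)

lemma abs_coord_le_norm: "\<bar>coord v i\<bar> \<le> norm v"
proof -
  obtain n where "v \<in> rspace n" "i < n"
  proof -
    obtain b where "\<forall>i\<in>{i. coord v i \<noteq> 0}. i < b"
      using finite_supp[of v] unfolding finite_nat_set_iff_bounded by blast
    then have "v \<in> rspace (max b (Suc i))"
      by (force simp: rspace_def)
    then show ?thesis by (rule that) simp
  qed
  then show ?thesis
    using member_le_L2_set[of "{..<n}" i "\<lambda>i. \<bar>coord v i\<bar>"]
    by (simp add: norm_rspace L2_set_def)
qed

text \<open>Makes \<open>onorm\<close> a genuine bound on the ambient space of all finitely
  supported sequences, so that \<open>mu\<close> controls norms.\<close>

lemma bounded_linear_matvec: "bounded_linear (matvec n A)"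
proof (rule bounded_linear_intro[where K="\<Sum>i<n. \<Sum>j<n. \<bar>A i j\<bar>"])
  fix x y r
  show "matvec n A (x + y) = matvec n A x + matvec n A y"
    by (intro rvec_eqI) (simp add: coord_matvec coord_simps distrib_left sum.distrib)
  show "matvec n A (r *\<^sub>R x) = r *\<^sub>R matvec n A x"
    by (intro rvec_eqI) (simp add: coord_matvec coord_simps sum_distrib_left mult_ac)
  have "norm (matvec n A x) \<le> (\<Sum>i<n. \<bar>coord (matvec n A x) i\<bar>)"
    by (simp add: norm_rspace[OF matvec_in_rspace] L2_set_le_sum_abs)
  also have "\<dots> \<le> (\<Sum>i<n. \<Sum>j<n. \<bar>A i j\<bar> * norm x)"
  proof (intro sum_mono)
    fix i assume "i \<in> {..<n}"
    then have "\<bar>coord (matvec n A x) i\<bar> \<le> (\<Sum>j<n. \<bar>A i j * coord x j\<bar>)"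
      by (simp add: coord_matvec)
    also have "\<dots> \<le> (\<Sum>j<n. \<bar>A i j\<bar> * norm x)"
      by (intro sum_mono) (simp add: abs_mult mult_left_mono abs_coord_le_norm)
    finally show "\<bar>coord (matvec n A x) i\<bar> \<le> (\<Sum>j<n. \<bar>A i j\<bar> * norm x)" .
  qed
  finally show "norm (matvec n A x) \<le> norm x * (\<Sum>i<n. \<Sum>j<n. \<bar>A i j\<bar>)"
    by (simp add: sum_distrib_left sum_distrib_right mult.commute)
qed

lemma matvec_selfadjoint:
  assumes "symmetric_matrix n A"
  shows "inner (matvec n A u) v = inner u (matvec n A v)"
proof -
  have "inner (matvec n A u) v = (\<Sum>i<n. \<Sum>j<n. A i j * coord u j * coord v i)"
    by (simp add: inner_rspace[OF matvec_in_rspace] coord_matvec sum_distrib_right)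
  also have "\<dots> = (\<Sum>j<n. \<Sum>i<n. A j i * coord u j * coord v i)"
    by (subst sum.swap) (use assms in \<open>simp add: symmetric_matrix_def\<close>)
  also have "\<dots> = inner (matvec n A v) u"
    by (simp add: inner_rspace[OF matvec_in_rspace] coord_matvec sum_distrib_right)
      (simp add: mult_ac)
  finally show ?thesis by (simp add: inner_commute)
qed

lemma matvec_diff: "matvec n (\<lambda>i j. A i j - B i j) v = matvec n A v - matvec n B v"
  by (intro rvec_eqI) (simp add: coord_matvec coord_simps left_diff_distrib sum_subtractf)

lemma matvec_scalar:
  assumes "v \<in> rspace n"
  shows "matvec n (\<lambda>i j. if i = j then a else 0) v = a *\<^sub>R v"
  using assms by (intro rvec_eqI) (auto simp: coord_matvec coord_simps rspace_def if_distrib[of "\<lambda>z. z * _"] cong: if_cong)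

text \<open>\<open>J\<close> annihilates mean-zero vectors, so there \<open>W\<close> agrees with
  \<open>W - J\<close> and Cauchy-Schwarz bounds its form by \<open>\<mu>\<close>. Unit column sums
  keep the subspace invariant, and the bound \<open>\<eta>\<close> gives nonnegativity.\<close>

lemma rspace_contraction_operator:
  assumes N: "2 \<le> N" and sym: "symmetric_matrix N W" and ds: "doubly_stochastic N W"
    and mu: "mu N W < 1" and eta: "0 < \<eta>"
    and psd: "pos_semidef N (\<lambda>i j. W i j - (if i = j then \<eta> else 0))"
  shows "contraction_operator (matvec N W) {v \<in> rspace N. (\<Sum>i<N. coord v i) = 0} (mu N W)"
proof -
  let ?S = "{v \<in> rspace N. (\<Sum>i<N. coord v i) = 0}"
  have lower: "\<eta> * inner u u \<le> inner u (matvec N W u)" if "u \<in> rspace N" for u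
    using psd that by (auto simp: pos_semidef_def matvec_diff matvec_scalar inner_diff_right)
  have upper: "inner u (matvec N W u) \<le> mu N W * inner u u" if "u \<in> ?S" for u
  proof -
    have "matvec N (\<lambda>i j. 1 / real N) u = 0"
      using that by (intro rvec_eqI) (simp add: coord_matvec coord_simps flip: sum_divide_distrib)
    then have "inner u (matvec N W u) = inner u (matvec N (\<lambda>i j. W i j - 1 / real N) u)"
      by (simp add: matvec_diff)
    also have "\<dots> \<le> norm u * norm (matvec N (\<lambda>i j. W i j - 1 / real N) u)"
      by (rule norm_cauchy_schwarz)
    also have "\<dots> \<le> norm u * (mu N W * norm u)"
      unfolding mu_def spectral_norm_def
      by (intro mult_left_mono onorm bounded_linear_matvec) auto
    finally show ?thesis by (simp add: dot_square_norm power2_eq_square mult_ac)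
  qed
  \<comment> \<open>A nonzero vector of mean zero forces \<open>\<eta> \<le> \<mu>\<close>, so \<open>\<mu>\<close> is positive.\<close>
  define e where "e = Rvec (\<lambda>i. if i = 0 then 1 else if i = 1 then - 1 else 0)"
  have coord_e: "coord e = (\<lambda>i. if i = 0 then 1 else if i = 1 then - 1 else 0)"
    unfolding e_def
    by (rule Rvec_inverse) (auto intro: finite_subset[of _ "{0, 1}"])
  have e_in: "e \<in> ?S"
  proof -
    have "(\<Sum>i<N. coord e i) = (\<Sum>i\<in>{0, 1}. coord e i)"
      using N by (intro sum.mono_neutral_right) (auto simp: coord_e)
    then show ?thesis using N by (simp add: coord_e rspace_def)
  qed
  have "e \<noteq> 0" using coord_e by (auto simp: coord_simps dest: fun_cong[of _ _ 0])
  then have "0 < \<eta> * inner e e" using eta by simp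
  also have "\<dots> \<le> mu N W * inner e e" using lower upper e_in by (metis (no_types, lifting) mem_Collect_eq order_trans)
  finally have mu_pos: "0 < mu N W" using inner_ge_zero[of e] by (auto simp: zero_less_mult_iff)
  show ?thesis
  proof (rule contraction_operator.intro)
    show "linear (matvec N W)" using bounded_linear_matvec bounded_linear.linear by blast
    show "inner (matvec N W u) v = inner u (matvec N W v)" for u v
      by (rule matvec_selfadjoint[OF sym])
    show "subspace ?S"
      using subspace_rspace[of N]
      by (auto simp: subspace_def coord_simps sum.distrib simp flip: sum_distrib_left)
    show "matvec N W u \<in> ?S" if "u \<in> ?S" for u
    proof -
      have "(\<Sum>i<N. coord (matvec N W u) i) = (\<Sum>j<N. \<Sum>i<N. W i j * coord u j)"
        by (subst sum.swap) (simp add: coord_matvec)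
      also have "\<dots> = (\<Sum>j<N. coord u j)"
        using ds by (simp add: doubly_stochastic_def flip: sum_distrib_right)
      finally show ?thesis using that by (simp add: matvec_in_rspace)
    qed
    show "0 \<le> inner u (matvec N W u)" if "u \<in> ?S" for u
    proof -
      have "0 \<le> \<eta> * inner u u" using eta by simp
      also have "\<dots> \<le> inner u (matvec N W u)" using lower that by blast
      finally show ?thesis .
    qed
    show "inner u (matvec N W u) \<le> mu N W * inner u u" if "u \<in> ?S" for u
      by (rule upper[OF that])
  qed (use mu mu_pos in auto)
qed

text \<open>Collects coordinate \<open>l\<close> of all nodes into one vector. Mixing acts on every
  slice by the same \<open>matvec\<close>, which takes the place of a Kronecker product with the
  identity.\<close>

definition slice :: "nat \<Rightarrow> (nat \<Rightarrow> rvec) \<Rightarrow> nat \<Rightarrow> rvec"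
  where "slice n X l = Rvec (\<lambda>i. if i < n then coord (X i) l else 0)"

lemma coord_slice: "coord (slice n X l) i = (if i < n then coord (X i) l else 0)"
  unfolding slice_def by (subst Rvec_inverse) (auto intro: finite_subset[of _ "{..<n}"])

lemma slice_in_rspace: "slice n X l \<in> rspace n"
  by (simp add: rspace_def coord_slice)

lemma slice_cong: "(\<And>i. i < n \<Longrightarrow> X i = Y i) \<Longrightarrow> slice n X l = slice n Y l"
  by (intro rvec_eqI) (simp add: coord_slice)

lemma slice_add: "slice n (\<lambda>i. X i + Y i) l = slice n X l + slice n Y l"
  by (intro rvec_eqI) (simp add: coord_slice coord_simps)

lemma slice_diff: "slice n (\<lambda>i. X i - Y i) l = slice n X l - slice n Y l"
  by (intro rvec_eqI) (simp add: coord_slice coord_simps)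

lemma slice_scaleR: "slice n (\<lambda>i. a *\<^sub>R X i) l = a *\<^sub>R slice n X l"
  by (intro rvec_eqI) (simp add: coord_slice coord_simps)

lemma slice_matvec: "slice n (\<lambda>i. \<Sum>j<n. W i j *\<^sub>R X j) l = matvec n W (slice n X l)"
  by (intro rvec_eqI) (simp add: coord_slice coord_matvec coord_sum coord_simps)

text \<open>Both sides are the Frobenius norm of the \<open>n\<close> by \<open>d\<close> array of
  coordinates, summed by columns or by rows.\<close>

lemma L2_set_norm_slice:
  assumes "\<And>i. i < n \<Longrightarrow> X i \<in> rspace d"
  shows "L2_set (\<lambda>l. norm (slice n X l)) {..<d} = L2_set (\<lambda>i. norm (X i)) {..<n}"
proof -
  have "(norm v)\<^sup>2 = (\<Sum>i<k. (coord v i)\<^sup>2)" if "v \<in> rspace k" for v k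
    unfolding power2_norm_eq_inner inner_rspace[OF that] by (simp add: power2_eq_square)
  note norm_sq = this
  have "(\<Sum>l<d. (norm (slice n X l))\<^sup>2) = (\<Sum>l<d. \<Sum>i<n. (coord (X i) l)\<^sup>2)"
    by (simp add: norm_sq[OF slice_in_rspace] coord_slice)
  also have "\<dots> = (\<Sum>i<n. \<Sum>l<d. (coord (X i) l)\<^sup>2)"
    by (rule sum.swap)
  also have "\<dots> = (\<Sum>i<n. (norm (X i))\<^sup>2)"
    using assms by (simp add: norm_sq[of _ d])
  finally show ?thesis by (simp add: L2_set_def)
qed

lemma L2_set_sum_le:
  assumes "finite T"
  shows "L2_set (\<lambda>i. \<Sum>t\<in>T. f t i) A \<le> (\<Sum>t\<in>T. L2_set (f t) A)"
  using assms
proof (induction T rule: finite_induct)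
  case (insert t T)
  have "L2_set (\<lambda>i. f t i + (\<Sum>t\<in>T. f t i)) A \<le> L2_set (f t) A + L2_set (\<lambda>i. \<Sum>t\<in>T. f t i) A"
    by (rule L2_set_triangle_ineq)
  then show ?case using insert by simp
qed (simp add: L2_set_def)

section \<open>Averages over the nodes\<close>

lemma sum_average:
  assumes "0 < n"
  shows "(\<Sum>i<n. z i) = real n *\<^sub>R average n z"
  using assms by (simp add: average_def)

text \<open>Parallel-axis identity: the deviations from the average sum to zero, so the cross term
  drops out.\<close>

lemma sum_sq_norm_average:
  assumes "0 < n"
  shows "(\<Sum>i<n. (norm (w - z i))\<^sup>2)
    = real n * (norm (w - average n z))\<^sup>2 + (\<Sum>i<n. (norm (z i - average n z))\<^sup>2)"
proof -
  let ?a = "average n z"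
  have "(norm (w - z i))\<^sup>2
      = (norm (w - ?a))\<^sup>2 - 2 * inner (w - ?a) (z i - ?a) + (norm (z i - ?a))\<^sup>2" for i
    unfolding power2_norm_eq_inner
    by (simp add: inner_diff_left inner_diff_right inner_commute algebra_simps)
  then have "(\<Sum>i<n. (norm (w - z i))\<^sup>2) = real n * (norm (w - ?a))\<^sup>2
      - 2 * inner (w - ?a) (\<Sum>i<n. z i - ?a) + (\<Sum>i<n. (norm (z i - ?a))\<^sup>2)"
    by (simp add: sum.distrib sum_subtractf[of _ "\<lambda>i. 2 * _ i"] inner_sum_right flip: sum_distrib_left)
  also have "(\<Sum>i<n. z i - ?a) = 0"
    using sum_average[OF assms, of z] by (simp add: sum_subtractf sum_constant_scaleR)
  finally show ?thesis by simp
qed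

lemma slice_mean_zero:
  assumes "0 < n"
  shows "(\<Sum>i<n. coord (slice n (\<lambda>i. z i - average n z) l) i) = 0"
proof -
  have "(\<Sum>i<n. z i - average n z) = 0"
    using sum_average[OF assms, of z] by (simp add: sum_subtractf sum_constant_scaleR)
  then have "coord (\<Sum>i<n. z i - average n z) l = 0" by (simp add: zero_rvec.rep_eq)
  then show ?thesis by (simp add: coord_slice coord_sum)
qed

lemma average_add: "average n (\<lambda>i. X i + Y i) = average n X + average n Y"
  by (simp add: average_def sum.distrib scaleR_right_distrib)

lemma average_diff: "average n (\<lambda>i. X i - Y i) = average n X - average n Y"
  by (simp add: average_def sum_subtractf scaleR_right_diff_distrib)

lemma average_scaleR: "average n (\<lambda>i. a *\<^sub>R X i) = a *\<^sub>R average n X"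
  by (simp add: average_def scaleR_sum_right[symmetric])

lemma average_cong: "(\<And>i. i < n \<Longrightarrow> X i = Y i) \<Longrightarrow> average n X = average n Y"
  by (simp add: average_def)

lemma norm_average_le:
  assumes "0 < n" "\<And>i. i < n \<Longrightarrow> norm (z i) \<le> G"
  shows "norm (average n z) \<le> G"
proof -
  have "norm (\<Sum>i<n. z i) \<le> (\<Sum>i<n. G)"
    using assms by (intro sum_norm_le) auto
  then show ?thesis using assms by (simp add: average_def field_simps)
qed

lemma average_in_subspace:
  assumes "subspace V" "\<And>i. i < n \<Longrightarrow> z i \<in> V"
  shows "average n z \<in> V"
  unfolding average_def using assms by (intro subspace_mul subspace_sum) auto

section \<open>Smooth convex functions\<close>

context
  fixes d :: nat and f :: "rvec \<Rightarrow> real" and grad :: "rvec \<Rightarrow> rvec"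
  assumes conv: "convex_on (rspace d) f"
    and grad: "\<And>z. z \<in> rspace d \<Longrightarrow> has_gradient d f (grad z) z"
begin

lemma line_in_rspace: "u \<in> rspace d \<Longrightarrow> v \<in> rspace d \<Longrightarrow> u + t *\<^sub>R (v - u) \<in> rspace d"
  using subspace_rspace by (simp add: subspace_add subspace_diff subspace_mul)

lemma line_has_derivative:
  assumes "u \<in> rspace d" "v \<in> rspace d"
  shows "((\<lambda>t. f (u + t *\<^sub>R (v - u))) has_real_derivative
    inner (v - u) (grad (u + t *\<^sub>R (v - u)))) (at t)"
proof -
  let ?\<gamma> = "\<lambda>t::real. u + t *\<^sub>R (v - u)"
  have "(?\<gamma> has_derivative (\<lambda>h. h *\<^sub>R (v - u))) (at t within UNIV)"
    by (auto intro!: derivative_eq_intros)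
  moreover have "(f has_derivative (\<lambda>h. inner h (grad (?\<gamma> t)))) (at (?\<gamma> t) within range ?\<gamma>)"
    using grad[OF line_in_rspace[OF assms]] line_in_rspace[OF assms]
    by (auto simp: has_gradient_def intro: has_derivative_subset)
  ultimately have "((\<lambda>t. f (?\<gamma> t)) has_derivative (\<lambda>h. inner (h *\<^sub>R (v - u)) (grad (?\<gamma> t))))
      (at t within UNIV)"
    by (rule has_derivative_in_compose)
  then show ?thesis
    by (simp add: has_field_derivative_def mult.commute[of _ "inner _ _"])
qed

lemma convex_gradient_below:
  assumes "u \<in> rspace d" "v \<in> rspace d"
  shows "f u + inner (grad u) (v - u) \<le> f v"
proof -
  let ?\<phi> = "\<lambda>t::real. f (u + t *\<^sub>R (v - u))"
  have "convex_on UNIV ?\<phi>"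
  proof (rule convex_onI)
    fix t a b :: real assume t: "0 < t" "t < 1"
    have "u + ((1 - t) *\<^sub>R a + t *\<^sub>R b) *\<^sub>R (v - u)
        = (1 - t) *\<^sub>R (u + a *\<^sub>R (v - u)) + t *\<^sub>R (u + b *\<^sub>R (v - u))"
      by (simp add: algebra_simps)
    then show "?\<phi> ((1 - t) *\<^sub>R a + t *\<^sub>R b) \<le> (1 - t) * ?\<phi> a + t * ?\<phi> b"
      using convex_onD[OF conv, of t] t line_in_rspace[OF assms] by simp
  qed simp
  then have "?\<phi> 1 - ?\<phi> 0 \<ge> inner (v - u) (grad (u + 0 *\<^sub>R (v - u))) * (1 - 0)"
    by (rule convex_on_imp_above_tangent)
      (use line_has_derivative[OF assms, of 0] in \<open>auto intro: has_field_derivative_at_within\<close>)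
  then show ?thesis by (simp add: inner_commute)
qed

text \<open>Instead of integrating the gradient along the segment, the quadratic bound is subtracted
  and the remainder is shown to be nonincreasing on \<open>[0, 1]\<close>.\<close>

lemma smooth_quadratic_above:
  assumes "u \<in> rspace d" "v \<in> rspace d"
    and lip: "\<And>u v. u \<in> rspace d \<Longrightarrow> v \<in> rspace d \<Longrightarrow> norm (grad u - grad v) \<le> L * norm (u - v)"
  shows "f v \<le> f u + inner (grad u) (v - u) + L / 2 * (norm (v - u))\<^sup>2"
proof -
  let ?h = "v - u"
  let ?\<psi> = "\<lambda>t::real. f (u + t *\<^sub>R ?h) - t * inner ?h (grad u) - L / 2 * t\<^sup>2 * (norm ?h)\<^sup>2"
  have "?\<psi> 1 \<le> ?\<psi> 0"
  proof (rule DERIV_nonpos_imp_nonincreasing[of 0 1 ?\<psi>])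
    fix t :: real assume t: "0 \<le> t" "t \<le> 1"
    have "inner ?h (grad (u + t *\<^sub>R ?h) - grad u) \<le> norm ?h * norm (grad (u + t *\<^sub>R ?h) - grad u)"
      by (rule norm_cauchy_schwarz)
    also have "\<dots> \<le> norm ?h * (L * norm (u + t *\<^sub>R ?h - u))"
      using assms line_in_rspace by (intro mult_left_mono lip) auto
    also have "\<dots> = L * t * (norm ?h)\<^sup>2"
      using t by (simp add: power2_eq_square)
    finally have "inner ?h (grad (u + t *\<^sub>R ?h)) - inner ?h (grad u) - L * t * (norm ?h)\<^sup>2 \<le> 0"
      by (simp add: inner_diff_right)
    moreover have "(?\<psi> has_real_derivative
        inner ?h (grad (u + t *\<^sub>R ?h)) - inner ?h (grad u) - L * t * (norm ?h)\<^sup>2) (at t)"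
      by (rule derivative_eq_intros line_has_derivative[OF assms(1,2)] refl)+ simp
    ultimately show "\<exists>y. (?\<psi> has_real_derivative y) (at t) \<and> y \<le> 0" by blast
  qed (rule zero_le_one)
  then show ?thesis by (simp add: inner_commute)
qed

lemma bounded_gradient_lipschitz:
  assumes "u \<in> rspace d" "v \<in> rspace d" "norm (grad u) \<le> G"
  shows "f u - f v \<le> G * norm (u - v)"
proof -
  have "f u - f v \<le> inner (grad u) (u - v)"
    using convex_gradient_below[OF assms(1,2)] by (simp add: inner_diff_right)
  also have "\<dots> \<le> norm (grad u) * norm (u - v)" by (rule norm_cauchy_schwarz)
  also have "\<dots> \<le> G * norm (u - v)" using assms by (intro mult_right_mono) auto
  finally show ?thesis .
qed

end

section \<open>Inexact accelerated gradient steps\<close>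

text \<open>\<open>h\<close> and \<open>g\<close> are an inexact value and slope at
  \<open>y\<close>: the affine lower bounds hold exactly, the quadratic upper bound up to \<delta>.
  The step trades the function gap against the distance of \<open>v\<close> from \<open>z\<close>,
  in a form that can be telescoped.\<close>

lemma inexact_nesterov_step:
  fixes x y v z g x' v' :: "'a::real_inner"
  assumes a: "0 < a" and \<theta>: "0 < \<theta>" "\<theta> \<le> 1"
    and below: "h + inner g (x - y) \<le> \<phi>x" "h + inner g (z - y) \<le> \<phi>z"
    and above: "\<phi>' \<le> h + inner g (x' - y) + 1 / (2 * a) * (norm (x' - y))\<^sup>2 + \<delta>"
    and x': "x' = y - a *\<^sub>R g" and y: "y = (1 - \<theta>) *\<^sub>R x + \<theta> *\<^sub>R v"
    and v': "v' = x + (1 / \<theta>) *\<^sub>R (x' - x)"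
  shows "\<phi>' - \<phi>z \<le> (1 - \<theta>) * (\<phi>x - \<phi>z) + \<delta>
    + \<theta>\<^sup>2 / (2 * a) * ((norm (v - z))\<^sup>2 - (norm (v' - z))\<^sup>2)"
proof -
  \<comment> \<open>Seen from this point, \<open>y\<close> and \<open>x'\<close> are \<theta> times
    \<open>v - z\<close> and \<open>v' - z\<close>.\<close>
  define w where "w = (1 - \<theta>) *\<^sub>R x + \<theta> *\<^sub>R z"
  have "y - w = \<theta> *\<^sub>R (v - z)" by (simp add: y w_def algebra_simps)
  then have yw: "(norm (y - w))\<^sup>2 = \<theta>\<^sup>2 * (norm (v - z))\<^sup>2" by (simp add: power_mult_distrib)
  have "x' - w = \<theta> *\<^sub>R (v' - z)" using \<theta> by (simp add: v' w_def algebra_simps)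
  then have xw: "(norm (x' - w))\<^sup>2 = \<theta>\<^sup>2 * (norm (v' - z))\<^sup>2" by (simp add: power_mult_distrib)
  have "(norm (y - w))\<^sup>2 - (norm (x' - w))\<^sup>2 = 2 * inner (y - x') (x' - w) + (norm (x' - y))\<^sup>2"
    unfolding power2_norm_eq_inner by (simp add: inner_diff_left inner_diff_right inner_commute)
  also have "y - x' = a *\<^sub>R g" by (simp add: x')
  finally have "\<theta>\<^sup>2 / (2 * a) * ((norm (v - z))\<^sup>2 - (norm (v' - z))\<^sup>2)
      = inner g (x' - w) + 1 / (2 * a) * (norm (x' - y))\<^sup>2"
    using a yw xw by (simp add: field_simps)
  moreover have "(1 - \<theta>) * (h + inner g (x - y)) + \<theta> * (h + inner g (z - y)) \<le> (1 - \<theta>) * \<phi>x + \<theta> * \<phi>z"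
    using below \<theta> by (intro add_mono mult_left_mono) auto
  moreover have "(1 - \<theta>) * (h + inner g (x - y)) + \<theta> * (h + inner g (z - y)) = h + inner g (w - y)"
    by (simp add: w_def inner_diff_right inner_add_right algebra_simps)
  ultimately show ?thesis
    using above by (simp add: inner_diff_right algebra_simps)
qed

lemma rate_combine:
  assumes "1 \<le> k" "0 \<le> a" "0 \<le> b" "0 \<le> e"
  shows "a * (1 / real k) + b * rate k (k - 1) + e * (1 / real k) \<le> (a + b + e) * rate k k"
proof -
  let ?s = "\<lambda>t. (real t + 2)\<^sup>2 / ((real t + 1) * (real t)\<^sup>2)"
  \<comment> \<open>The term \<open>t = 1\<close> equals \<open>9/2\<close>, so the sum exceeds
    \<open>1\<close> and \<open>rate k k\<close> dominates \<open>1 / k\<close>.\<close>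
  have "?s 1 \<le> sum ?s {1..k}"
    using assms by (intro member_le_sum) auto
  then have "1 \<le> sum ?s {1..k}" by simp
  then have 1: "1 / real k \<le> rate k k"
    unfolding rate_def by (simp add: divide_right_mono)
  have "sum ?s {1..k - 1} \<le> sum ?s {1..k}"
    by (intro sum_mono2) auto
  then have 2: "rate k (k - 1) \<le> rate k k"
    unfolding rate_def by (intro mult_left_mono) auto
  have "a * (1 / real k) + b * rate k (k - 1) + e * (1 / real k)
      \<le> a * rate k k + b * rate k k + e * rate k k"
    using 1 2 assms by (intro add_mono mult_left_mono)
  then show ?thesis by (simp add: algebra_simps)
qed

section \<open>The distributed algorithm\<close>

locale dng =
  fixes N :: nat and E :: "nat set set" and W :: "nat \<Rightarrow> nat \<Rightarrow> real" and d :: nat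
    and f :: "nat \<Rightarrow> rvec \<Rightarrow> real" and grad :: "nat \<Rightarrow> rvec \<Rightarrow> rvec"
    and L G c \<eta> :: real and x y :: "nat \<Rightarrow> nat \<Rightarrow> rvec"
  assumes N: "2 \<le> N" and graph: "simple_graph N E" and weights: "weight_matrix N E W"
    and mu_less: "mu N W < 1" and \<eta>: "0 < \<eta>" "\<eta> < 1"
    and psd: "pos_semidef N (\<lambda>i j. W i j - (if i = j then \<eta> else 0))"
    and L: "0 \<le> L" and G: "0 \<le> G" and c: "0 < c"
    and convex: "i < N \<Longrightarrow> convex_on (rspace d) (f i)"
    and gradient: "i < N \<Longrightarrow> z \<in> rspace d \<Longrightarrow> has_gradient d (f i) (grad i z) z"
    and lipschitz: "i < N \<Longrightarrow> u \<in> rspace d \<Longrightarrow> v \<in> rspace d \<Longrightarrow>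
      norm (grad i u - grad i v) \<le> L * norm (u - v)"
    and bounded: "i < N \<Longrightarrow> z \<in> rspace d \<Longrightarrow> norm (grad i z) \<le> G"
    and iterates: "dng_iterates N E W d grad c x y"
begin

lemma N_pos: "0 < N" "0 < real N"
  using N by auto

text \<open>Outside the neighborhood a weight is nonnegative but not positive, hence zero; the local
  sum is thus a full matrix product.\<close>

lemma sum_neighborhood:
  fixes z :: "nat \<Rightarrow> rvec"
  assumes i: "i < N"
  shows "(\<Sum>j\<in>neighborhood E i. W i j *\<^sub>R z j) = (\<Sum>j<N. W i j *\<^sub>R z j)"
proof (rule sum.mono_neutral_left)
  show "neighborhood E i \<subseteq> {..<N}"
  proof
    fix j assume j: "j \<in> neighborhood E i"
    show "j \<in> {..<N}"
    proof (cases "j = i")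
      case False
      then have "{i, j} \<in> E" using j by (simp add: neighborhood_def)
      then obtain u v where "{i, j} = {u, v}" "u < N" "v < N"
        using graph unfolding simple_graph_def by blast
      then show ?thesis by (auto simp: doubleton_eq_iff)
    qed (use i in simp)
  qed
  show "\<forall>j\<in>{..<N} - neighborhood E i. W i j *\<^sub>R z j = 0"
  proof
    fix j assume "j \<in> {..<N} - neighborhood E i"
    then have "j < N" "j \<noteq> i" "{i, j} \<notin> E" by (auto simp: neighborhood_def)
    then have "\<not> 0 < W i j" "0 \<le> W i j"
      using weights i unfolding weight_matrix_def doubly_stochastic_def by metis+
    then show "W i j *\<^sub>R z j = 0" by simp
  qed
qed simp

lemma iterates_step:
  assumes "i < N" "1 \<le> k"
  shows "x i k = (\<Sum>j\<in>neighborhood E i. W i j *\<^sub>R y j (k - 1)) - step_size c (k - 1) *\<^sub>R grad i (y i (k - 1))"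
    and "y i k = x i k + momentum (k - 1) *\<^sub>R (x i k - x i (k - 1))"
  using iterates assms unfolding dng_iterates_def by blast+

lemma x_Suc:
  assumes "i < N"
  shows "x i (Suc k) = (\<Sum>j<N. W i j *\<^sub>R y j k) - step_size c k *\<^sub>R grad i (y i k)"
  using iterates_step(1)[OF assms, of "Suc k"] sum_neighborhood[OF assms] by simp

lemma x_0: "i < N \<Longrightarrow> j < N \<Longrightarrow> x i 0 = x j 0"
  and y_0: "i < N \<Longrightarrow> y i 0 = x i 0"
  and x_0_in: "i < N \<Longrightarrow> x i 0 \<in> rspace d"
  using iterates unfolding dng_iterates_def by metis+

text \<open>Extends the update rule to \<open>k = 0\<close>, where \<open>k - 1\<close> is again
  \<open>0\<close> and the increment vanishes.\<close>

lemma y_eq: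
  assumes "i < N"
  shows "y i k = x i k + momentum (k - 1) *\<^sub>R (x i k - x i (k - 1))"
proof (cases k)
  case 0
  then show ?thesis using y_0[OF assms] by simp
next
  case (Suc m)
  then show ?thesis using iterates_step(2)[OF assms, of k] by simp
qed

lemma grad_in: "i < N \<Longrightarrow> z \<in> rspace d \<Longrightarrow> grad i z \<in> rspace d"
  using gradient by (auto simp: has_gradient_def)

lemma x_in_y_in: "i < N \<Longrightarrow> x i k \<in> rspace d \<and> y i k \<in> rspace d"
proof (induction k arbitrary: i)
  case 0
  then show ?case using x_0_in y_0 by simp
next
  case (Suc k)
  have x: "x i (Suc k) \<in> rspace d"
    unfolding x_Suc[OF Suc.prems] using Suc grad_in subspace_rspace[of d]
    by (auto intro!: subspace_diff subspace_sum subspace_mul)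
  moreover have "y i (Suc k) \<in> rspace d"
    unfolding y_eq[OF Suc.prems, of "Suc k"] using x Suc subspace_rspace[of d]
    by (auto intro!: subspace_add subspace_diff subspace_mul)
  ultimately show ?case by blast
qed

lemma x_in: "i < N \<Longrightarrow> x i k \<in> rspace d" and y_in: "i < N \<Longrightarrow> y i k \<in> rspace d"
  using x_in_y_in by auto

section \<open>Dynamics of the network averages\<close>

definition xbar where "xbar k = average N (\<lambda>i. x i k)"
definition ybar where "ybar k = average N (\<lambda>i. y i k)"
definition gbar where "gbar k = average N (\<lambda>i. grad i (y i k))"

lemma xbar_in: "xbar k \<in> rspace d" and ybar_in: "ybar k \<in> rspace d"
  and gbar_in: "gbar k \<in> rspace d"
  unfolding xbar_def ybar_def gbar_def using x_in y_in grad_in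
  by (auto intro!: average_in_subspace subspace_rspace)

lemma norm_gbar_le: "norm (gbar k) \<le> G"
  unfolding gbar_def using bounded y_in N_pos by (intro norm_average_le) auto

text \<open>The columns of \<open>W\<close> sum to one, so mixing preserves the average, which
  therefore takes a centralized step along \<open>gbar\<close>.\<close>

lemma xbar_Suc: "xbar (Suc k) = ybar k - step_size c k *\<^sub>R gbar k"
proof -
  have "(\<Sum>i<N. \<Sum>j<N. W i j *\<^sub>R y j k) = (\<Sum>j<N. (\<Sum>i<N. W i j) *\<^sub>R y j k)"
    by (subst sum.swap) (simp add: scaleR_sum_left)
  also have "\<dots> = (\<Sum>j<N. y j k)"
    using weights by (simp add: weight_matrix_def doubly_stochastic_def)
  finally have "average N (\<lambda>i. \<Sum>j<N. W i j *\<^sub>R y j k) = ybar k"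
    by (simp add: average_def ybar_def)
  moreover have "xbar (Suc k)
      = average N (\<lambda>i. (\<Sum>j<N. W i j *\<^sub>R y j k) - step_size c k *\<^sub>R grad i (y i k))"
    unfolding xbar_def by (intro average_cong) (rule x_Suc)
  ultimately show ?thesis by (simp add: average_diff average_scaleR gbar_def)
qed

lemma ybar_eq: "ybar k = xbar k + momentum (k - 1) *\<^sub>R (xbar k - xbar (k - 1))"
proof -
  have "ybar k = average N (\<lambda>i. x i k + momentum (k - 1) *\<^sub>R (x i k - x i (k - 1)))"
    unfolding ybar_def by (intro average_cong) (rule y_eq)
  then show ?thesis by (simp add: average_add average_diff average_scaleR xbar_def)
qed

lemma momentum_bounds: "0 \<le> momentum k" "momentum k \<le> 1"
  by (auto simp: momentum_def)

lemma step_size_bounds: "0 < step_size c k" "step_size c k \<le> c"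
  using c by (auto simp: step_size_def field_simps)

section \<open>Disagreement between the nodes\<close>

definition x_dev where "x_dev k = L2_set (\<lambda>i. norm (x i k - xbar k)) {..<N}"
definition y_dev where "y_dev k = L2_set (\<lambda>i. norm (y i k - ybar k)) {..<N}"

lemma x_dev_0: "x_dev 0 = 0"
proof -
  have "xbar 0 = x i 0" if "i < N" for i
  proof -
    have "xbar 0 = average N (\<lambda>_. x i 0)"
      unfolding xbar_def by (intro average_cong x_0 that)
    then show ?thesis using N_pos by (simp add: average_def sum_constant_scaleR)
  qed
  then show ?thesis by (simp add: x_dev_def L2_set_def)
qed

text \<open>Subtracting the mean does not increase a sum of squares: the parallel-axis identity at
  the origin.\<close>

lemma gradient_dev_le:
  "L2_set (\<lambda>i. norm (grad i (y i k) - gbar k)) {..<N} \<le> sqrt (real N) * G"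
proof -
  have "(\<Sum>i<N. (norm (grad i (y i k) - gbar k))\<^sup>2) \<le> (\<Sum>i<N. (norm (grad i (y i k)))\<^sup>2)"
    using sum_sq_norm_average[OF N_pos(1), of 0 "\<lambda>i. grad i (y i k)"] N_pos by (simp add: gbar_def)
  also have "\<dots> \<le> (\<Sum>i<N. G\<^sup>2)"
    using bounded y_in by (intro sum_mono power_mono) auto
  finally show ?thesis
    unfolding L2_set_def using G by (intro real_le_lsqrt) (auto simp: power_mult_distrib)
qed

text \<open>The left side is what the convolution bound yields for the ratio
  \<open>sqrt \<mu>\<close>; the factor \<open>sqrt (1 - \<mu>)\<close> is lost in passing from the
  energy to the norm.\<close>

lemma C_cons_bounds:
  "(2 * B_const (sqrt (mu N W)) + 6 / (1 - sqrt (mu N W))) \<le> C_cons (mu N W) \<eta> * sqrt (1 - mu N W)"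
  "0 \<le> C_cons (mu N W) \<eta>"
proof -
  interpret contraction_operator "matvec N W" "{v \<in> rspace N. (\<Sum>i<N. coord v i) = 0}" "mu N W"
    using rspace_contraction_operator[OF N _ _ mu_less \<eta>(1) psd] weights
    by (simp add: weight_matrix_def)
  let ?m = "mu N W" and ?r = "sqrt (mu N W)"
  let ?B = "B_const ?r"
  have r: "0 < ?r" "?r < 1" using m_pos m_less by auto
  have B: "0 \<le> ?B" using r by (rule B_const_nonneg)
  have "(1 - ?r) * (1 + ?r) = 1 - ?m"
    using m_pos by (simp add: algebra_simps)
  then have "1 / (1 - ?r) = (1 + ?r) / (1 - ?m)"
    using r m_less by (simp add: field_simps)
  also have "\<dots> \<le> 2 / (1 - ?m)"
    using r m_less by (intro divide_right_mono) auto
  finally have 1: "1 / (1 - ?r) \<le> 2 * (1 / (1 - ?m))" by simp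
  have pos: "0 \<le> 2 * ?B + 7 / (1 - ?m)" "0 \<le> 1 / (1 - ?m)" using B m_less by auto
  have "6 * (1 / (1 - ?r)) \<le> 6 * (2 * (1 / (1 - ?m)))"
    using 1 by (intro mult_left_mono) auto
  \<comment> \<open>\<open>56 = 8 * 7\<close> is the coefficient of \<open>1 / (1 - \<mu>)\<close>
    in the numerator of \<open>C_cons\<close>.\<close>
  also have "\<dots> \<le> 56 * (1 / (1 - ?m))" using mult_right_mono[of 12 56, OF _ pos(2)] by simp
  finally have "2 * ?B + 6 / (1 - ?r) \<le> 8 * (2 * ?B + 7 / (1 - ?m))"
    using B by (simp add: algebra_simps)
  also have "\<dots> \<le> 8 * (2 * ?B + 7 / (1 - ?m)) / sqrt \<eta>"
  proof -
    have "v \<le> v / sqrt \<eta>" if "0 \<le> v" for v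
      using that \<eta> by (simp add: pos_le_divide_eq mult_left_le)
    then show ?thesis using pos(1) by simp
  qed
  also have "\<dots> = C_cons ?m \<eta> * sqrt (1 - ?m)"
    using m_less \<eta> by (simp add: C_cons_def real_sqrt_mult)
  finally show "2 * ?B + 6 / (1 - ?r) \<le> C_cons ?m \<eta> * sqrt (1 - ?m)" .
  show "0 \<le> C_cons ?m \<eta>"
    unfolding C_cons_def using pos m_less \<eta> by (intro divide_nonneg_nonneg) auto
qed

text \<open>Every slice of the deviations obeys the abstract momentum recursion. Minkowski's
  inequality combines the slices, and the convolution bound gives the decay. At \<open>k = 0\<close>
  both sides vanish, the right one by division by zero.\<close>

lemma x_dev_le: "x_dev k \<le> sqrt (real N) * c * G * C_cons (mu N W) \<eta> / real k"
proof (cases "k = 0")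
  case True
  then show ?thesis using x_dev_0 by simp
next
  case False
  let ?m = "mu N W" and ?S = "{v \<in> rspace N. (\<Sum>i<N. coord v i) = 0}"
  interpret contraction_operator "matvec N W" ?S ?m
    using rspace_contraction_operator[OF N _ _ mu_less \<eta>(1) psd] weights
    by (simp add: weight_matrix_def)
  define P where "P l k = slice N (\<lambda>i. x i k - xbar k) l" for l k
  define U where "U l k = slice N (\<lambda>i. grad i (y i k) - gbar k) l" for l k
  have P_0: "P l 0 = 0" for l
  proof -
    have "norm (x i 0 - xbar 0) \<le> 0" if "i < N" for i
      using member_le_L2_set[of "{..<N}" i "\<lambda>i. norm (x i 0 - xbar 0)"] that x_dev_0
      by (simp add: x_dev_def)
    then show ?thesis by (intro rvec_eqI) (auto simp: P_def coord_slice coord_simps)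
  qed
  have Y: "slice N (\<lambda>i. y i k - ybar k) l = P l k + momentum (k - 1) *\<^sub>R (P l k - P l (k - 1))" for l k
  proof -
    have "slice N (\<lambda>i. y i k - ybar k) l = slice N (\<lambda>i. (x i k - xbar k)
        + momentum (k - 1) *\<^sub>R ((x i k - xbar k) - (x i (k - 1) - xbar (k - 1)))) l"
      by (rule slice_cong) (subst y_eq, assumption, subst ybar_eq, simp add: algebra_simps)
    then show ?thesis unfolding slice_add slice_scaleR slice_diff P_def by simp
  qed
  have P_Suc: "P l (Suc k) = matvec N W (P l k + momentum (k - 1) *\<^sub>R (P l k - P l (k - 1)))
      - step_size c k *\<^sub>R U l k" for l k
  proof -
    have "x i (Suc k) - xbar (Suc k) = (\<Sum>j<N. W i j *\<^sub>R (y j k - ybar k))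
        - step_size c k *\<^sub>R (grad i (y i k) - gbar k)" if "i < N" for i
    proof -
      have "(\<Sum>j<N. W i j *\<^sub>R ybar k) = ybar k"
        using weights that by (simp add: weight_matrix_def doubly_stochastic_def flip: scaleR_sum_left)
      then show ?thesis
        by (simp add: x_Suc[OF that] xbar_Suc scaleR_right_diff_distrib sum_subtractf)
    qed
    then have "P l (Suc k) = slice N (\<lambda>i. (\<Sum>j<N. W i j *\<^sub>R (y j k - ybar k))
        - step_size c k *\<^sub>R (grad i (y i k) - gbar k)) l"
      unfolding P_def by (rule slice_cong)
    also have "\<dots> = matvec N W (slice N (\<lambda>i. y i k - ybar k) l) - step_size c k *\<^sub>R U l k"
      unfolding U_def slice_matvec[symmetric] slice_scaleR[symmetric] by (rule slice_diff)
    finally show ?thesis unfolding Y .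
  qed
  have P_in: "P l k \<in> ?S" for l k
    unfolding P_def xbar_def using slice_mean_zero[OF N_pos(1)] by (simp add: slice_in_rspace)
  let ?w = "\<lambda>t. sqrt ?m ^ (k - 1 - t) * step_size c t"
  have w: "0 \<le> ?w t" for t using m_pos step_size_bounds(1)[of t] by simp
  have bound: "sqrt (1 - ?m) * norm (P l k) \<le> (\<Sum>t<k. ?w t * norm (U l t))" for l
    by (rule momentum_recursion_bound[where b="\<lambda>k. momentum (k - 1)", OF P_0 P_Suc P_in
          momentum_bounds less_imp_le[OF step_size_bounds(1)]])
  have "sqrt (1 - ?m) * x_dev k = sqrt (1 - ?m) * L2_set (\<lambda>l. norm (P l k)) {..<d}"
    unfolding x_dev_def P_def using x_in xbar_in subspace_rspace
    by (subst L2_set_norm_slice) (auto intro: subspace_diff)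
  also have "\<dots> = L2_set (\<lambda>l. sqrt (1 - ?m) * norm (P l k)) {..<d}"
    using m_less by (intro L2_set_right_distrib) auto
  also have "\<dots> \<le> L2_set (\<lambda>l. \<Sum>t<k. ?w t * norm (U l t)) {..<d}"
    using bound m_less by (intro L2_set_mono) auto
  also have "\<dots> \<le> (\<Sum>t<k. L2_set (\<lambda>l. ?w t * norm (U l t)) {..<d})"
    by (rule L2_set_sum_le) simp
  also have "\<dots> \<le> (\<Sum>t<k. ?w t * (sqrt (real N) * G))"
  proof (rule sum_mono)
    fix t
    have "L2_set (\<lambda>l. norm (U l t)) {..<d} \<le> sqrt (real N) * G"
      unfolding U_def using gradient_dev_le y_in grad_in gbar_in subspace_rspace
      by (subst L2_set_norm_slice) (auto intro: subspace_diff)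
    then show "L2_set (\<lambda>l. ?w t * norm (U l t)) {..<d} \<le> ?w t * (sqrt (real N) * G)"
      using w by (subst L2_set_right_distrib[symmetric]) (auto intro: mult_left_mono)
  qed
  also have "\<dots> = c * sqrt (real N) * G * (\<Sum>t<k. sqrt ?m ^ (k - 1 - t) / (real t + 1))"
    unfolding sum_distrib_left by (rule sum.cong) (auto simp: step_size_def)
  finally have "real k * (sqrt (1 - ?m) * x_dev k)
      \<le> real k * (c * sqrt (real N) * G * (\<Sum>t<k. sqrt ?m ^ (k - 1 - t) / (real t + 1)))"
    by (intro mult_left_mono) auto
  also have "\<dots> = c * sqrt (real N) * G * (real k * (\<Sum>t<k. sqrt ?m ^ (k - 1 - t) / (real t + 1)))"
    by (simp only: mult_ac)
  also have "\<dots> \<le> c * sqrt (real N) * G * (C_cons ?m \<eta> * sqrt (1 - ?m))"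
  proof (rule mult_left_mono)
    show "real k * (\<Sum>t<k. sqrt ?m ^ (k - 1 - t) / (real t + 1)) \<le> C_cons ?m \<eta> * sqrt (1 - ?m)"
      using geometric_harmonic_convolution_le[of "sqrt ?m" k] C_cons_bounds(1) m_pos m_less False
      by simp
  qed (use c G in simp)
  finally have "sqrt (1 - ?m) * (real k * x_dev k)
      \<le> sqrt (1 - ?m) * (c * sqrt (real N) * G * C_cons ?m \<eta>)"
    by (simp add: mult_ac)
  then have "real k * x_dev k \<le> c * sqrt (real N) * G * C_cons ?m \<eta>"
    by (rule mult_left_le_imp_le) (use m_less in simp)
  then show ?thesis using False by (simp add: field_simps)
qed

lemma y_dev_le: "y_dev k \<le> 4 * (sqrt (real N) * c * G * C_cons (mu N W) \<eta>) / real k"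
proof -
  let ?Q = "sqrt (real N) * c * G * C_cons (mu N W) \<eta>"
  have Q: "0 \<le> ?Q" using c G C_cons_bounds(2) by simp
  have "norm (y i k - ybar k) \<le> 2 * norm (x i k - xbar k) + norm (x i (k - 1) - xbar (k - 1))"
    if "i < N" for i
  proof -
    let ?b = "momentum (k - 1)"
    have "y i k - ybar k = (1 + ?b) *\<^sub>R (x i k - xbar k) - ?b *\<^sub>R (x i (k - 1) - xbar (k - 1))"
      by (subst y_eq[OF that], subst ybar_eq) (simp add: algebra_simps)
    then have "norm (y i k - ybar k) \<le> \<bar>1 + ?b\<bar> * norm (x i k - xbar k) + \<bar>?b\<bar> * norm (x i (k - 1) - xbar (k - 1))"
      by (metis norm_scaleR norm_triangle_ineq4)
    also have "\<dots> \<le> 2 * norm (x i k - xbar k) + 1 * norm (x i (k - 1) - xbar (k - 1))"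
      using momentum_bounds[of "k - 1"] by (intro add_mono mult_right_mono) auto
    finally show ?thesis by simp
  qed
  then have "y_dev k \<le> L2_set (\<lambda>i. 2 * norm (x i k - xbar k) + norm (x i (k - 1) - xbar (k - 1))) {..<N}"
    unfolding y_dev_def by (intro L2_set_mono) auto
  also have "\<dots> \<le> 2 * x_dev k + x_dev (k - 1)"
    unfolding x_dev_def L2_set_right_distrib[OF zero_le_numeral] by (rule L2_set_triangle_ineq)
  also have "\<dots> \<le> 2 * (?Q / real k) + 2 * (?Q / real k)"
  proof -
    \<comment> \<open>For \<open>k >= 2\<close> this is \<open>1 / (k - 1) <= 2 / k\<close>; for
      smaller \<open>k\<close> the left side is \<open>x_dev 0 = 0\<close>.\<close>
    have "x_dev (k - 1) \<le> 2 * (?Q / real k)"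
    proof (cases "k \<le> 1")
      case True
      then have "k - 1 = 0" by simp
      then show ?thesis using Q by (simp add: x_dev_0)
    next
      case False
      have "x_dev (k - 1) \<le> ?Q / real (k - 1)" by (rule x_dev_le)
      also have "\<dots> \<le> ?Q / (real k / 2)"
        using False Q by (intro divide_left_mono) auto
      finally show ?thesis by (simp add: mult_ac)
    qed
    then show ?thesis using x_dev_le[of k] by (intro add_mono) auto
  qed
  also have "\<dots> = 4 * ?Q / real k" by simp
  finally show ?thesis .
qed

section \<open>The averaged objective and its inexact first-order model\<close>

definition obj where "obj z = (\<Sum>i<N. f i z) / real N"

text \<open>The tangents of the \<open>f i\<close> at the nodes' own points, averaged and evaluated
  at \<open>ybar k\<close>. With the slope \<open>gbar k\<close> it forms the inexact oracle for
  \<open>obj\<close>.\<close>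

definition model where
  "model k = (\<Sum>i<N. f i (y i k) + inner (grad i (y i k)) (ybar k - y i k)) / real N"

lemma model_eq:
  "model k + inner (gbar k) (z - ybar k)
    = (\<Sum>i<N. f i (y i k) + inner (grad i (y i k)) (z - y i k)) / real N"
proof -
  have "inner (gbar k) (z - ybar k) = (\<Sum>i<N. inner (grad i (y i k)) (z - ybar k)) / real N"
    by (simp add: gbar_def average_def inner_sum_left)
  then show ?thesis
    by (simp add: model_def inner_diff_right sum.distrib flip: add_divide_distrib)
      (simp add: sum_subtractf)
qed

lemma model_below:
  assumes "z \<in> rspace d"
  shows "model k + inner (gbar k) (z - ybar k) \<le> obj z"
  unfolding model_eq obj_def using convex gradient y_in assms
  by (intro divide_right_mono sum_mono convex_gradient_below) auto

text \<open>The quadratic bounds are centred at the individual \<open>y i k\<close>; the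
  parallel-axis identity recentres them at \<open>ybar k\<close> and leaves the disagreement as the
  oracle error.\<close>

lemma model_above:
  assumes "z \<in> rspace d"
  shows "obj z \<le> model k + inner (gbar k) (z - ybar k) + L / 2 * (norm (z - ybar k))\<^sup>2
    + L / (2 * real N) * (y_dev k)\<^sup>2"
proof -
  have "obj z \<le> (\<Sum>i<N. f i (y i k) + inner (grad i (y i k)) (z - y i k)
      + L / 2 * (norm (z - y i k))\<^sup>2) / real N"
    unfolding obj_def using convex gradient lipschitz y_in assms
    by (intro divide_right_mono sum_mono smooth_quadratic_above) auto
  also have "\<dots> = (\<Sum>i<N. f i (y i k) + inner (grad i (y i k)) (z - y i k)) / real N
      + L / 2 * (\<Sum>i<N. (norm (z - y i k))\<^sup>2) / real N"
    by (simp add: sum.distrib sum_distrib_left add_divide_distrib)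
  also have "(\<Sum>i<N. (norm (z - y i k))\<^sup>2) = real N * (norm (z - ybar k))\<^sup>2 + (y_dev k)\<^sup>2"
    unfolding sum_sq_norm_average[OF N_pos(1), of z "\<lambda>i. y i k"]
    by (simp add: y_dev_def L2_set_def ybar_def sum_nonneg)
  finally show ?thesis
    unfolding model_eq using N_pos by (simp add: field_simps)
qed

lemma obj_lipschitz:
  assumes "u \<in> rspace d" "v \<in> rspace d"
  shows "obj u - obj v \<le> G * norm (u - v)"
proof -
  have "(\<Sum>i<N. f i u - f i v) \<le> (\<Sum>i<N. G * norm (u - v))"
    using convex gradient bounded assms by (intro sum_mono bounded_gradient_lipschitz) auto
  then show ?thesis
    using N_pos by (simp add: obj_def sum_subtractf field_simps)
qed

section \<open>Descent of the Lyapunov function\<close>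

definition vseq where
  "vseq k = xbar (k - 1) + ((real k + 1) / 2) *\<^sub>R (xbar k - xbar (k - 1))"

text \<open>At \<open>k = 0\<close> the first coefficient is \<open>1 / 0 = 0\<close>, which is the value the telescoping needs.\<close>

definition lyapunov where
  "lyapunov z k = (real k + 1)\<^sup>2 / real k * (obj (xbar k) - obj z) + 2 / c * (norm (vseq k - z))\<^sup>2"

text \<open>\<open>vseq k\<close> extrapolates the last step by \<open>(k + 1) / 2\<close>, the
  inverse of the previous Nesterov weight. The momentum \<open>(k - 1) / (k + 2)\<close> is exactly
  the one for which \<open>ybar k\<close> is this convex combination with weight
  \<open>2 / (k + 2)\<close>. At \<open>k = 0\<close> all three points coincide.\<close>

lemma ybar_vseq:
  "ybar k = (1 - 2 / (real k + 2)) *\<^sub>R xbar k + (2 / (real k + 2)) *\<^sub>R vseq k"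
proof (cases k)
  case 0
  then show ?thesis using ybar_eq[of 0] by (simp add: vseq_def)
next
  case (Suc m)
  let ?D = "xbar k - xbar m"
  have coef: "momentum m = 2 / (real k + 2) * ((real k + 1) / 2) - 2 / (real k + 2)"
  proof -
    have k: "real k + 2 = real m + 3" "real k + 1 = real m + 2" by (simp_all add: Suc)
    have "2 / p * (q / 2) = q / p" for p q :: real by simp
    then have "2 / (real m + 3) * ((real m + 2) / 2) - 2 / (real m + 3) = (real m + 2 - 2) / (real m + 3)"
      by (metis diff_divide_distrib)
    then show ?thesis unfolding k momentum_def by simp
  qed
  have "ybar k = xbar k + momentum m *\<^sub>R ?D" using ybar_eq[of k] by (simp add: Suc)
  also have "\<dots> = (1 - 2 / (real k + 2)) *\<^sub>R xbar k
      + (2 / (real k + 2)) *\<^sub>R (xbar m + ((real k + 1) / 2) *\<^sub>R ?D)"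
    unfolding coef by (simp add: scaleR_left_diff_distrib scaleR_right_diff_distrib
        scaleR_right_distrib del: times_divide_eq_left times_divide_eq_right)
  finally show ?thesis by (simp add: vseq_def Suc)
qed

lemma lyapunov_step:
  assumes z: "z \<in> rspace d" and min: "obj z \<le> obj (xbar k)" and small: "L * c \<le> real k + 1"
  shows "lyapunov z (Suc k)
    \<le> lyapunov z k + (real k + 2)\<^sup>2 / (real k + 1) * (L / (2 * real N) * (y_dev k)\<^sup>2)"
proof -
  let ?a = "step_size c k" and ?\<theta> = "2 / (real k + 2)"
  let ?e = "obj (xbar k) - obj z" and ?\<delta> = "L / (2 * real N) * (y_dev k)\<^sup>2"
  \<comment> \<open>Multiplying by this weight turns the coefficient
    \<open>\<theta>^2 / (2 a)\<close> of the distances into \<open>2 / c\<close> for every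
    \<open>k\<close>, so they telescope although the step size decreases.\<close>
  let ?M = "(real k + 2)\<^sup>2 / (real k + 1)"
  let ?D = "(norm (vseq k - z))\<^sup>2 - (norm (vseq (Suc k) - z))\<^sup>2"
  have La: "L / 2 \<le> 1 / (2 * ?a)"
    using small c by (simp add: step_size_def field_simps)
  have "obj (xbar (Suc k)) - obj z \<le> (1 - ?\<theta>) * ?e + ?\<delta> + ?\<theta>\<^sup>2 / (2 * ?a) * ?D"
  proof (rule inexact_nesterov_step)
    show "0 < ?a" by (rule step_size_bounds)
    show "model k + inner (gbar k) (xbar k - ybar k) \<le> obj (xbar k)"
      and "model k + inner (gbar k) (z - ybar k) \<le> obj z"
      using model_below xbar_in z by auto
    show "obj (xbar (Suc k)) \<le> model k + inner (gbar k) (xbar (Suc k) - ybar k)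
        + 1 / (2 * ?a) * (norm (xbar (Suc k) - ybar k))\<^sup>2 + ?\<delta>"
      using model_above[OF xbar_in, of "Suc k" k]
        mult_right_mono[OF La zero_le_power2, of "norm (xbar (Suc k) - ybar k)"] by linarith
    show "xbar (Suc k) = ybar k - ?a *\<^sub>R gbar k" by (rule xbar_Suc)
    show "ybar k = (1 - ?\<theta>) *\<^sub>R xbar k + ?\<theta> *\<^sub>R vseq k" by (rule ybar_vseq)
    show "vseq (Suc k) = xbar k + (1 / ?\<theta>) *\<^sub>R (xbar (Suc k) - xbar k)"
      by (simp add: vseq_def add.commute)
  qed auto
  then have "?M * (obj (xbar (Suc k)) - obj z)
      \<le> ?M * ((1 - ?\<theta>) * ?e + ?\<delta> + ?\<theta>\<^sup>2 / (2 * ?a) * ?D)"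
    by (intro mult_left_mono) auto
  also have "\<dots> = ?M * (1 - ?\<theta>) * ?e + ?M * ?\<delta> + (?M * (?\<theta>\<^sup>2 / (2 * ?a))) * ?D"
    by (simp only: distrib_left mult.assoc)
  also have "?M * (?\<theta>\<^sup>2 / (2 * ?a)) = 2 / c"
  proof -
    have "p\<^sup>2 / q * ((2 / p)\<^sup>2 / (2 * (c / q))) = 2 / c" if "0 < p" "0 < q" for p q :: real
      using that c by (simp add: field_simps)
    from this[of "real k + 2" "real k + 1"] show ?thesis unfolding step_size_def by simp
  qed
  also have "?M * (1 - ?\<theta>) = real k * (real k + 2) / (real k + 1)"
  proof -
    have "p\<^sup>2 / q * (1 - 2 / p) = (p - 2) * p / q" if "0 < p" "0 < q" for p q :: real
      using that by (simp add: field_simps power2_eq_square)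
    from this[of "real k + 2" "real k + 1"] show ?thesis by simp
  qed
  finally have *: "?M * (obj (xbar (Suc k)) - obj z)
      \<le> real k * (real k + 2) / (real k + 1) * ?e + ?M * ?\<delta> + 2 / c * ?D" .
  \<comment> \<open>This is \<open>k^2 * (k + 2) <= (k + 1)^3\<close>; at \<open>k = 0\<close> both
    sides are zero. The gap it multiplies is nonnegative by minimality.\<close>
  have "real k * (real k + 2) / (real k + 1) \<le> (real k + 1)\<^sup>2 / real k"
  proof (cases "k = 0")
    case False
    then show ?thesis
      by (intro frac_le) (auto simp: power2_eq_square algebra_simps)
  qed simp
  then have "real k * (real k + 2) / (real k + 1) * ?e \<le> (real k + 1)\<^sup>2 / real k * ?e"
    using min by (intro mult_right_mono) auto
  with * show ?thesis
    by (simp add: lyapunov_def right_diff_distrib add.commute)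
qed

lemma lyapunov_le:
  assumes z: "z \<in> rspace d" and min: "\<And>u. u \<in> rspace d \<Longrightarrow> obj z \<le> obj u"
    and small: "L * c \<le> real k0 + 1" and k: "k0 \<le> k"
  shows "lyapunov z k \<le> lyapunov z k0
    + (\<Sum>t=k0..<k. (real t + 2)\<^sup>2 / (real t + 1) * (L / (2 * real N) * (y_dev t)\<^sup>2))"
  using k
proof (induction k rule: dec_induct)
  case (step k)
  then show ?case
    using lyapunov_step[OF z min[OF xbar_in], of k] small by simp
qed simp

lemma lyapunov_le_sum:
  assumes z: "z \<in> rspace d" and min: "\<And>u. u \<in> rspace d \<Longrightarrow> obj z \<le> obj u"
    and small: "L * c \<le> real k0 + 1" and k: "k0 \<le> k"
  shows "lyapunov z k \<le> lyapunov z k0 + 16 * c\<^sup>2 * L * (C_cons (mu N W) \<eta>)\<^sup>2 * G\<^sup>2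
    * (\<Sum>t=1..k - 1. (real t + 2)\<^sup>2 / ((real t + 1) * (real t)\<^sup>2))"
proof -
  let ?K = "C_cons (mu N W) \<eta>"
  let ?Q = "sqrt (real N) * c * G * ?K"
  let ?A = "16 * c\<^sup>2 * L * ?K\<^sup>2 * G\<^sup>2"
  let ?s = "\<lambda>t. (real t + 2)\<^sup>2 / ((real t + 1) * (real t)\<^sup>2)"
  have A: "0 \<le> ?A" using L by simp
  have term_le: "(real t + 2)\<^sup>2 / (real t + 1) * (L / (2 * real N) * (y_dev t)\<^sup>2) \<le> ?A * ?s t" for t
  proof -
    have "(y_dev t)\<^sup>2 \<le> (4 * ?Q / real t)\<^sup>2"
      by (intro power_mono y_dev_le) (simp add: y_dev_def)
    then have "L / (2 * real N) * (y_dev t)\<^sup>2 \<le> L / (2 * real N) * (4 * ?Q / real t)\<^sup>2"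
      using L by (intro mult_left_mono) auto
    \<comment> \<open>The square of \<open>sqrt N\<close> in the consensus bound cancels the
      \<open>N\<close> of the oracle error.\<close>
    also have "\<dots> = ?A / 2 / (real t)\<^sup>2"
      using N_pos by (simp add: power_divide power_mult_distrib)
    also have "\<dots> \<le> ?A / (real t)\<^sup>2"
      using A by (intro divide_right_mono) auto
    finally have "(real t + 2)\<^sup>2 / (real t + 1) * (L / (2 * real N) * (y_dev t)\<^sup>2)
        \<le> (real t + 2)\<^sup>2 / (real t + 1) * (?A / (real t)\<^sup>2)"
      by (intro mult_left_mono) auto
    then show ?thesis by (simp add: mult_ac)
  qed
  have "(\<Sum>t=k0..<k. (real t + 2)\<^sup>2 / (real t + 1) * (L / (2 * real N) * (y_dev t)\<^sup>2))
      \<le> (\<Sum>t=k0..<k. ?A * ?s t)"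
    by (rule sum_mono) (rule term_le)
  also have "\<dots> \<le> (\<Sum>t=0..<k. ?A * ?s t)"
    using A by (intro sum_mono2) auto
  \<comment> \<open>The term \<open>t = 0\<close> is zero by division by zero, in agreement with
    \<open>y_dev 0 = 0\<close>.\<close>
  also have "\<dots> = (\<Sum>t=1..k - 1. ?A * ?s t)"
    by (rule sum.mono_neutral_right) (auto simp: not_less_eq_eq)
  finally show ?thesis
    using lyapunov_le[OF assms] by (simp add: sum_distrib_left)
qed

text \<open>The gap at a node is the gap at the average, controlled by the Lyapunov function, plus
  the passage from average to node, controlled by the gradient bound and consensus. The starting
  index \<open>k0\<close> is left free to serve both regimes of \<open>c\<close>.\<close>

lemma gap_le:
  assumes z: "z \<in> rspace d" and min: "\<And>u. u \<in> rspace d \<Longrightarrow> obj z \<le> obj u"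
    and small: "L * c \<le> real k0 + 1" and k: "k0 \<le> k" "1 \<le> k" and i: "i < N"
  shows "obj (x i k) - obj z \<le> lyapunov z k0 * (1 / real k)
    + 16 * c\<^sup>2 * L * (C_cons (mu N W) \<eta>)\<^sup>2 * G\<^sup>2 * rate k (k - 1)
    + c * sqrt (real N) * G\<^sup>2 * C_cons (mu N W) \<eta> * (1 / real k)"
proof -
  let ?e = "obj (xbar k) - obj z"
  have "obj (x i k) - obj (xbar k) \<le> G * norm (x i k - xbar k)"
    using obj_lipschitz x_in xbar_in i by blast
  also have "\<dots> \<le> G * x_dev k"
    unfolding x_dev_def using i G
    by (intro mult_left_mono member_le_L2_set[of _ _ "\<lambda>i. norm (x i k - xbar k)"]) auto
  also have "\<dots> \<le> G * (sqrt (real N) * c * G * C_cons (mu N W) \<eta> / real k)"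
    using G by (intro mult_left_mono x_dev_le)
  finally have 1: "obj (x i k) - obj (xbar k)
      \<le> c * sqrt (real N) * G\<^sup>2 * C_cons (mu N W) \<eta> * (1 / real k)"
    by (simp add: power2_eq_square mult_ac)
  have "real k * ?e \<le> (real k + 1)\<^sup>2 / real k * ?e"
    using k min[OF xbar_in] by (intro mult_right_mono) (auto simp: field_simps power2_eq_square)
  also have "\<dots> \<le> lyapunov z k" using c by (simp add: lyapunov_def)
  also have "\<dots> \<le> lyapunov z k0 + 16 * c\<^sup>2 * L * (C_cons (mu N W) \<eta>)\<^sup>2 * G\<^sup>2
    * (\<Sum>t=1..k - 1. (real t + 2)\<^sup>2 / ((real t + 1) * (real t)\<^sup>2))" (is "_ \<le> ?r")
    by (rule lyapunov_le_sum[OF z min small k(1)])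
  finally have "1 / real k * (real k * ?e) \<le> 1 / real k * ?r"
    by (rule mult_left_mono) simp
  then have "?e \<le> lyapunov z k0 * (1 / real k)
      + 16 * c\<^sup>2 * L * (C_cons (mu N W) \<eta>)\<^sup>2 * G\<^sup>2 * rate k (k - 1)"
    using k by (simp add: rate_def distrib_left mult_ac)
  with 1 show ?thesis by simp
qed

section \<open>Growth of the averages under bounded gradients\<close>

lemma xbar_step_le: "norm (xbar k - xbar (k - 1)) \<le> real k * (c * G)"
proof (induction k)
  case (Suc k)
  let ?D = "xbar k - xbar (k - 1)"
  have "norm (xbar (Suc k) - xbar k) = norm (momentum (k - 1) *\<^sub>R ?D - step_size c k *\<^sub>R gbar k)"
    by (simp add: xbar_Suc ybar_eq[of k])
  also have "\<dots> \<le> momentum (k - 1) * norm ?D + step_size c k * norm (gbar k)"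
    using norm_triangle_ineq4[of "momentum (k - 1) *\<^sub>R ?D" "step_size c k *\<^sub>R gbar k"]
      momentum_bounds(1)[of "k - 1"] step_size_bounds(1)[of k] by simp
  \<comment> \<open>Momentum is at most one, so each iteration lengthens the step by at most
    \<open>c * G\<close>.\<close>
  also have "\<dots> \<le> 1 * norm ?D + c * G"
    using momentum_bounds(2)[of "k - 1"] step_size_bounds[of k] norm_gbar_le[of k] c
    by (intro add_mono mult_mono) auto
  also have "\<dots> \<le> real (Suc k) * (c * G)"
    using Suc by (simp add: algebra_simps)
  finally show ?case by simp
qed simp

lemma xbar_dist_le: "norm (xbar k - xbar 0) \<le> (real k)\<^sup>2 * (c * G)"
proof (induction k)
  case (Suc k)
  have "norm (xbar (Suc k) - xbar 0) \<le> norm (xbar (Suc k) - xbar k) + norm (xbar k - xbar 0)"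
    by (rule norm_diff_triangle_le) auto
  also have "\<dots> \<le> real (Suc k) * (c * G) + (real k)\<^sup>2 * (c * G)"
    using Suc xbar_step_le[of "Suc k"] by simp
  also have "\<dots> \<le> (real (Suc k))\<^sup>2 * (c * G)"
    using c G by (simp only: distrib_right[symmetric], intro mult_right_mono)
      (auto simp: power2_eq_square algebra_simps)
  finally show ?case .
qed simp

text \<open>Only the gradient bound enters, so at an index determined by \<open>c\<close> and
  \<open>L\<close> the right side is a constant free of the network.\<close>

lemma lyapunov_crude:
  assumes z: "z \<in> rspace d" and R: "norm (xbar 0 - z) \<le> R"
  shows "lyapunov z k \<le> (real k + 1)\<^sup>2 / real k * (G * (R + (real k)\<^sup>2 * (c * G)))
    + 2 / c * (R + (real k)\<^sup>2 * (c * G) + (real k + 1) / 2 * (real k * (c * G)))\<^sup>2"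
proof -
  have dist: "norm (xbar j - z) \<le> R + (real j)\<^sup>2 * (c * G)" for j
    using norm_triangle_ineq[of "xbar 0 - z" "xbar j - xbar 0"] R xbar_dist_le[of j] by simp
  have "obj (xbar k) - obj z \<le> G * (R + (real k)\<^sup>2 * (c * G))"
    using obj_lipschitz[OF xbar_in z, of k] mult_left_mono[OF dist G, of k] by linarith
  moreover have "norm (vseq k - z)
      \<le> R + (real k)\<^sup>2 * (c * G) + (real k + 1) / 2 * (real k * (c * G))"
  proof -
    have "norm (vseq k - z) \<le> norm (xbar (k - 1) - z)
        + norm (((real k + 1) / 2) *\<^sub>R (xbar k - xbar (k - 1)))"
      using norm_triangle_ineq[of "xbar (k - 1) - z" "((real k + 1) / 2) *\<^sub>R (xbar k - xbar (k - 1))"]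
      by (simp add: vseq_def algebra_simps)
    also have "norm (((real k + 1) / 2) *\<^sub>R (xbar k - xbar (k - 1)))
        \<le> (real k + 1) / 2 * (real k * (c * G))"
      unfolding norm_scaleR using xbar_step_le[of k] by (intro mult_mono) auto
    also have "norm (xbar (k - 1) - z) \<le> R + (real k)\<^sup>2 * (c * G)"
    proof -
      have "(real (k - 1))\<^sup>2 * (c * G) \<le> (real k)\<^sup>2 * (c * G)"
        using c G by (intro mult_right_mono power_mono) auto
      then show ?thesis using dist[of "k - 1"] by linarith
    qed
    finally show ?thesis by simp
  qed
  ultimately show ?thesis
    unfolding lyapunov_def using c by (intro add_mono mult_left_mono power_mono) auto
qed

end

text \<open>
  The descent argument needs \<open>\<alpha>\<^sub>k * L \<le> 1\<close>, which may fail for the first steps if \<open>c\<close> is large. Up to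
  \<open>k = \<lceil>2cL\<rceil>\<close> the averages move at most \<open>k * c * G\<close> per step, whatever the network.
\<close>

definition burn_in_const :: "real \<Rightarrow> real \<Rightarrow> real \<Rightarrow> real \<Rightarrow> real"
  where "burn_in_const L G R c = (let k = real (nat \<lceil>2 * c * L\<rceil>) in
    (k + 1)\<^sup>2 / k * (G * (R + k\<^sup>2 * (c * G)))
      + 2 / c * (R + k\<^sup>2 * (c * G) + (k + 1) / 2 * (k * (c * G)))\<^sup>2)"

lemma burn_in_const_nonneg:
  assumes "0 \<le> L" "0 \<le> G" "0 \<le> R" "0 < c"
  shows "0 \<le> burn_in_const L G R c"
proof -
  have "0 \<le> (k + 1)\<^sup>2 / k * (G * (R + k\<^sup>2 * (c * G)))
      + 2 / c * (R + k\<^sup>2 * (c * G) + (k + 1) / 2 * (k * (c * G)))\<^sup>2" if "0 \<le> k" for k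
    using assms that by simp
  then show ?thesis unfolding burn_in_const_def Let_def by (simp only: of_nat_0_le_iff)
qed

theorem theorem5:
  shows "\<exists>C'' :: real \<Rightarrow> real \<Rightarrow> real \<Rightarrow> real \<Rightarrow> real.
    (\<forall>L G R c. 0 \<le> L \<and> 0 \<le> G \<and> 0 \<le> R \<and> 0 < c \<longrightarrow> 0 \<le> C'' L G R c) \<and>
    (\<forall>(N::nat) (E :: nat set set) (W :: nat \<Rightarrow> nat \<Rightarrow> real) (d::nat)
        (f :: nat \<Rightarrow> rvec \<Rightarrow> real) (grad :: nat \<Rightarrow> rvec \<Rightarrow> rvec)
        (L::real) (G::real) (R::real) (c::real) (\<eta>::real) (xstar :: rvec)
        (x :: nat \<Rightarrow> nat \<Rightarrow> rvec) (y :: nat \<Rightarrow> nat \<Rightarrow> rvec).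
      let F = (\<lambda>z. \<Sum>i<N. f i z);
          gap = (\<lambda>i k. (F (x i k) - F xstar) / real N);
          K = C_cons (mu N W) \<eta>
      in
        2 \<le> N \<and> 1 \<le> d \<and>
        simple_graph N E \<and> connected_graph N E \<and> weight_matrix N E W \<and>
        mu N W < 1 \<and>
        0 < \<eta> \<and> \<eta> < 1 \<and> pos_semidef N (\<lambda>i j. W i j - (if i = j then \<eta> else 0)) \<and>
        0 \<le> L \<and> 0 \<le> G \<and> 0 \<le> R \<and> 0 < c \<and>
        (\<forall>i<N. convex_on (rspace d) (f i)) \<and>
        (\<forall>i<N. \<forall>z\<in>rspace d. has_gradient d (f i) (grad i z) z) \<and>
        (\<forall>i<N. \<forall>u\<in>rspace d. \<forall>v\<in>rspace d. norm (grad i u - grad i v) \<le> L * norm (u - v)) \<and>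
        (\<forall>i<N. \<forall>z\<in>rspace d. norm (grad i z) \<le> G) \<and>
        is_arg_min F (\<lambda>z. z \<in> rspace d) xstar \<and>
        dng_iterates N E W d grad c x y \<and>
        norm (average N (\<lambda>i. x i 0) - xstar) \<le> R
      \<longrightarrow>
        (ereal c \<le> inv_2L L \<longrightarrow>
          (\<forall>i<N. \<forall>k\<ge>1.
            gap i k \<le> 2 * R\<^sup>2 / c * (1 / real k) + 16 * c\<^sup>2 * L * K\<^sup>2 * G\<^sup>2 * rate k (k - 1)
                         + c * sqrt (real N) * G\<^sup>2 * K * (1 / real k) \<and>
            2 * R\<^sup>2 / c * (1 / real k) + 16 * c\<^sup>2 * L * K\<^sup>2 * G\<^sup>2 * rate k (k - 1)
                + c * sqrt (real N) * G\<^sup>2 * K * (1 / real k)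
              \<le> (2 * R\<^sup>2 / c + 16 * c\<^sup>2 * L * K\<^sup>2 * G\<^sup>2 + c * sqrt (real N) * G\<^sup>2 * K)
                  * rate k k)) \<and>
        ((\<forall>i<N. x i 0 = 0 \<and> y i 0 = 0) \<and> ereal c > inv_2L L \<longrightarrow>
          (\<forall>i<N. \<forall>k. real k \<ge> 2 * c * L \<longrightarrow>
            gap i k \<le> (C'' L G R c + 16 * c\<^sup>2 * L * K\<^sup>2 * G\<^sup>2 + c * sqrt (real N) * G\<^sup>2 * K)
                        * rate k k)))"
proof (intro exI[of _ burn_in_const] conjI allI, goal_cases)
  case (1 L G R c)
  then show ?case using burn_in_const_nonneg by blast
next
  case (2 N E W d f grad L G R c \<eta> xstar x y)
  show ?case
    unfolding Let_def
  proof (intro impI, elim conjE, goal_cases)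
    case 1
    interpret dng N E W d f grad L G c \<eta> x y
      by (rule dng.intro[OF 1(1) 1(3) 1(5-11) 1(13) 1(14-17)[rule_format] 1(19)])
    let ?K = "C_cons (mu N W) \<eta>"
    let ?A = "16 * c\<^sup>2 * L * ?K\<^sup>2 * G\<^sup>2" and ?B = "c * sqrt (real N) * G\<^sup>2 * ?K"
    have AB: "0 \<le> ?A" "0 \<le> ?B" using L c C_cons_bounds(2) by auto
    have R: "0 \<le> R" "norm (xbar 0 - xstar) \<le> R" using 1 by (auto simp: xbar_def)
    have z: "xstar \<in> rspace d" and argmin: "is_arg_min (\<lambda>z. \<Sum>i<N. f i z) (\<lambda>z. z \<in> rspace d) xstar"
      using 1 by (auto simp: is_arg_min_def)
    have min: "obj xstar \<le> obj u" if "u \<in> rspace d" for u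
      using argmin that by (auto simp: is_arg_min_linorder obj_def intro: divide_right_mono)
    have gap: "((\<Sum>j<N. f j (x i k)) - (\<Sum>j<N. f j xstar)) / real N = obj (x i k) - obj xstar" for i k
      by (simp add: obj_def diff_divide_distrib)
    show ?case
    proof (intro conjI impI allI, goal_cases)
      case (1 i k)
      \<comment> \<open>Descent holds from \<open>k0 = 0\<close> on, where the Lyapunov function
        reduces to its distance term.\<close>
      have small: "L * c \<le> real 0 + 1"
        using 1(1) L c by (auto simp: inv_2L_def field_simps split: if_splits)
      have "lyapunov xstar 0 \<le> 2 / c * R\<^sup>2"
        using R c by (simp add: lyapunov_def vseq_def) (intro divide_right_mono mult_left_mono power_mono, auto)
      then have "lyapunov xstar 0 * (1 / real k) \<le> 2 * R\<^sup>2 / c * (1 / real k)"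
        by (intro mult_right_mono) auto
      then show ?case
        unfolding gap using gap_le[OF z min small, of k i] 1 by simp
    next
      case (2 i k)
      then show ?case
        using AB c by (intro rate_combine) auto
    next
      case (3 i k)
      let ?k0 = "nat \<lceil>2 * c * L\<rceil>"
      \<comment> \<open>For \<open>L = 0\<close> the threshold is infinite and no real
        \<open>c\<close> exceeds it. The strict bound forces \<open>k >= 1\<close>.\<close>
      have big: "1 < 2 * c * L"
        using 3(1) L c by (auto simp: inv_2L_def field_simps split: if_splits)
      have "2 * c * L \<le> real k" using 3 by simp
      then have k: "?k0 \<le> k" "1 \<le> k" using big by linarith+
      have "2 * (L * c) \<le> real ?k0"
        using real_nat_ceiling_ge[of "2 * c * L"] by (simp add: mult_ac)
      then have small: "L * c \<le> real ?k0 + 1"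
        using L c mult_nonneg_nonneg[of L c] by linarith
      have "obj (x i k) - obj xstar \<le> lyapunov xstar ?k0 * (1 / real k) + ?A * rate k (k - 1) + ?B * (1 / real k)"
        by (rule gap_le[OF z min small k]) (use 3 in auto)
      also have "\<dots> \<le> burn_in_const L G R c * (1 / real k) + ?A * rate k (k - 1) + ?B * (1 / real k)"
      proof -
        have "lyapunov xstar ?k0 \<le> burn_in_const L G R c"
          unfolding burn_in_const_def Let_def by (rule lyapunov_crude[OF z R(2)])
        from mult_right_mono[OF this, of "1 / real k"] show ?thesis by simp
      qed
      also have "\<dots> \<le> (burn_in_const L G R c + ?A + ?B) * rate k k"
        using AB burn_in_const_nonneg[OF L G R(1) c] k by (intro rate_combine)
      finally show ?case unfolding gap .
    qed
  qed
qed

end
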